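(* Let $\Delta,k\in\mathbb{N}$ with $\Delta\geq 3$ and $k\geq 5$. Then there exists a $\Delta$-regular graph $G$ on $n=2k(\Delta+1)$ vertices that satisfies the following. Let $\mathcal{H}$ denote the subgraph of the $(\Delta+1)$-recolouring graph of $G$ induced by the set $\Omega(G)\setminus\Omega^*(G)$ of non-frozen $(\Delta+1)$-colourings. Then the Glauber dynamics for $(\Delta+1)$-colourings of $G$ restricted to $V(\mathcal{H})$ is ergodic and has mixing time at least $$\frac{n^2}{8(\Delta+1)}.$$
   Context: All graphs are finite, simple and labeled, with vertex set $[n]=\{1,\dots,n\}$. A (proper) $k$-colouring of $G$ is a function $\alpha:V(G)\to[k]$ with $\alpha(x)\neq\alpha(y)$ for every edge $xy$. The $k$-recolouring graph of $G$ has as vertices the proper $k$-colourings of $G$, two being adjacent if and only if they differ at exactly one vertex of $G$. For $G$ of maximum degree $\Delta$, $\Omega(G)$ is the set of proper $(\Delta+1)$-colourings of $G$, and $\Omega^*(G)$ is the set of frozen ones, i.e. those $\alpha\in\Omega(G)$ such that for every vertex $v$ all $\Delta+1$ colours appear in the closed neighbourhood $N[v]=N(v)\cup\{v\}$. (Frozen colourings are fixed points of the Glauber dynamics defined next and are isolated vertices of the recolouring graph.) The Glauber dynamics for $k$-colourings of $G$ is the Markov chain $(X_t)$ on the set of proper $k$-colourings of $G$ with the following transitions: choose $v\in[n]$ and $c\in[k]$ independently and uniformly at random; set $X_{t+1}(u)=X_t(u)$ for all $u\neq v$; if $c$ does not appear (under $X_t$) on the neighbours of $v$, set $X_{t+1}(v)=c$,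 otherwise set $X_{t+1}(v)=X_t(v)$. Ergodic means irreducible and aperiodic. For an irreducible aperiodic Markov chain on a finite set $\Omega$ with transition matrix $P$ and stationary distribution $\pi$, let $d(t)=\max_{x\in\Omega}\|P^t(x,\cdot)-\pi\|_{TV}$, where $\|\mu-\nu\|_{TV}=\max_{A\subseteq\Omega}|\mu(A)-\nu(A)|$. The mixing time is $\min\{t: d(t)\leq 1/4\}$. *)

theory Defs
  imports
    "HOL-Probability.Probability"
    "Graph_Theory.Digraph_Component"
begin

section \<open>Graphs, colourings and the recolouring graph\<close>

text \<open>
  Finite simple graphs are \<^locale>\<open>pair_graph\<close>s: loop-free symmetric digraphs on a finite vertex
  set, an edge \<open>uv\<close> being the pair of arcs \<open>(u, v)\<close>, \<open>(v, u)\<close>. Degrees are therefore out-degrees.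
\<close>

definition neighbourhood :: "'v pair_pre_digraph \<Rightarrow> 'v \<Rightarrow> 'v set" where
  "neighbourhood G v = {u. (v, u) \<in> parcs G}"

definition regular_graph :: "nat \<Rightarrow> 'v pair_pre_digraph \<Rightarrow> bool" where
  "regular_graph d G \<longleftrightarrow> pair_graph G \<and> (\<forall>v \<in> pverts G. out_degree (with_proj G) v = d)"

text \<open>
  Colourings are extensional (\<^const>\<open>undefined\<close> off the vertex set), so that equality of colourings
  means equality on the vertices.
\<close>

definition colourings :: "'v pair_pre_digraph \<Rightarrow> nat \<Rightarrow> ('v \<Rightarrow> nat) set" where
  "colourings G q =
    {\<alpha> \<in> pverts G \<rightarrow>\<^sub>E {1..q}. \<forall>x y. (x, y) \<in> parcs G \<longrightarrow> \<alpha> x \<noteq> \<alpha> y}"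

definition frozen_colourings :: "'v pair_pre_digraph \<Rightarrow> nat \<Rightarrow> ('v \<Rightarrow> nat) set" where
  "frozen_colourings G q =
    {\<alpha> \<in> colourings G q. \<forall>v \<in> pverts G. {1..q} \<subseteq> \<alpha> ` insert v (neighbourhood G v)}"

definition recolouring_graph :: "'v pair_pre_digraph \<Rightarrow> nat \<Rightarrow> ('v \<Rightarrow> nat) pair_pre_digraph" where
  "recolouring_graph G q =
    \<lparr> pverts = colourings G q,
      parcs = {(\<alpha>, \<beta>). \<alpha> \<in> colourings G q \<and> \<beta> \<in> colourings G q \<and>
                       (\<exists>!v. v \<in> pverts G \<and> \<alpha> v \<noteq> \<beta> v)} \<rparr>"


section \<open>Finite Markov chains\<close>

text \<open>
  A transition matrix \<open>P\<close> is given by a kernel \<open>K\<close> with \<open>P(x, y) = pmf (K x) y\<close>. The chain lives on a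
  finite state space \<open>S\<close> that \<open>K\<close> does not leave; restricting a chain to a closed subset of its states
  means keeping \<open>K\<close> and shrinking \<open>S\<close>.
\<close>

definition markov_chain_on :: "'s set \<Rightarrow> ('s \<Rightarrow> 's pmf) \<Rightarrow> bool" where
  "markov_chain_on S K \<longleftrightarrow> finite S \<and> S \<noteq> {} \<and> (\<forall>x \<in> S. set_pmf (K x) \<subseteq> S)"

text \<open>The distribution \<open>P\<^sup>t(x, \<cdot>)\<close>:\<close>

primrec steps :: "('s \<Rightarrow> 's pmf) \<Rightarrow> nat \<Rightarrow> 's \<Rightarrow> 's pmf" where
  "steps K 0 x = return_pmf x"
| "steps K (Suc t) x = bind_pmf (steps K t x) K"

definition irreducible_on :: "'s set \<Rightarrow> ('s \<Rightarrow> 's pmf) \<Rightarrow> bool" where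
  "irreducible_on S K \<longleftrightarrow> (\<forall>x \<in> S. \<forall>y \<in> S. \<exists>t. pmf (steps K t x) y > 0)"

definition aperiodic_on :: "'s set \<Rightarrow> ('s \<Rightarrow> 's pmf) \<Rightarrow> bool" where
  "aperiodic_on S K \<longleftrightarrow> (\<forall>x \<in> S. Gcd {t. t \<ge> 1 \<and> pmf (steps K t x) x > 0} = 1)"

definition ergodic_on :: "'s set \<Rightarrow> ('s \<Rightarrow> 's pmf) \<Rightarrow> bool" where
  "ergodic_on S K \<longleftrightarrow> irreducible_on S K \<and> aperiodic_on S K"

definition stationary_on :: "'s set \<Rightarrow> ('s \<Rightarrow> 's pmf) \<Rightarrow> 's pmf \<Rightarrow> bool" where
  "stationary_on S K \<pi> \<longleftrightarrow> set_pmf \<pi> \<subseteq> S \<and> bind_pmf \<pi> K = \<pi>"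

text \<open>
  The next definitions are meaningful only for irreducible aperiodic chains, where the stationary
  distribution is unique and \<open>d(t) \<longlonglongrightarrow> 0\<close>.
\<close>

definition stationary_distribution :: "'s set \<Rightarrow> ('s \<Rightarrow> 's pmf) \<Rightarrow> 's pmf" where
  "stationary_distribution S K = (THE \<pi>. stationary_on S K \<pi>)"

definition tv_dist :: "'s set \<Rightarrow> 's pmf \<Rightarrow> 's pmf \<Rightarrow> real" where
  "tv_dist S \<mu> \<nu> = Max ((\<lambda>A. \<bar>measure_pmf.prob \<mu> A - measure_pmf.prob \<nu> A\<bar>) ` Pow S)"

definition dist_to_stationarity :: "'s set \<Rightarrow> ('s \<Rightarrow> 's pmf) \<Rightarrow> nat \<Rightarrow> real" where
  "dist_to_stationarity S K t =
    Max ((\<lambda>x. tv_dist S (steps K t x) (stationary_distribution S K)) ` S)"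

definition mixing_time :: "'s set \<Rightarrow> ('s \<Rightarrow> 's pmf) \<Rightarrow> nat" where
  "mixing_time S K = (LEAST t. dist_to_stationarity S K t \<le> 1 / 4)"


section \<open>Glauber dynamics\<close>

definition glauber :: "'v pair_pre_digraph \<Rightarrow> nat \<Rightarrow> ('v \<Rightarrow> nat) \<Rightarrow> ('v \<Rightarrow> nat) pmf" where
  "glauber G q \<alpha> =
    map_pmf (\<lambda>(v, c). if c \<notin> \<alpha> ` neighbourhood G v then \<alpha>(v := c) else \<alpha>)
      (pair_pmf (pmf_of_set (pverts G)) (pmf_of_set {1..q}))"

end

theory Submission
  imports Defs
begin

text \<open>
  The graph is a ring of \<open>2k\<close> blocks, each a \<open>(\<Delta> + 1)\<close>-clique minus an edge, whose two endpoints are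
  joined to the neighbouring blocks. Call a block loose if these endpoints have the same colour.

  Ergodicity: a non-frozen colouring reaches one with a loose block, looseness spreads around the ring
  as there are at least four colours, and once every block is loose the colours of the blocks can be
  changed as in a colouring of an even cycle with at least four colours, while the spare colour of a
  loose block allows its middle vertices to be permuted.

  Mixing time: start from a colouring that looks frozen except in one block. A block coloured as in the
  frozen colouring can change only at an endpoint next to a changed block, so the changed region grows
  by one block with probability at most \<open>2 / n\<close> per step. Hence for \<open>t < k n / 4 = n\<^sup>2 / (8 (\<Delta> + 1))\<close> the
  block opposite to the start still has its initial colours with probability above \<open>1 / 2\<close>, whereas
  in the stationary distribution, which is uniform because the chain is symmetric, a given
  vertex has a given colour with probability at most \<open>1 / (\<Delta> + 1) \<le> 1 / 4\<close> by symmetry of the colours.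
\<close>

section \<open>Symmetric Markov chains\<close>

lemma prob_bind_pmf_finite:
  assumes "finite S" and "set_pmf p \<subseteq> S"
  shows "measure_pmf.prob (bind_pmf p f) A = (\<Sum>y\<in>S. pmf p y * measure_pmf.prob (f y) A)"
proof -
  have "ennreal (measure_pmf.prob (bind_pmf p f) A)
      = (\<integral>\<^sup>+y. ennreal (measure_pmf.prob (f y) A) \<partial>measure_pmf p)"
    by (simp flip: measure_pmf.emeasure_eq_measure)
  also have "\<dots> = ennreal (\<integral>y. measure_pmf.prob (f y) A \<partial>measure_pmf p)"
    by (intro nn_integral_eq_integral measure_pmf.integrable_const_bound[where B = 1]) auto
  finally have "measure_pmf.prob (bind_pmf p f) A
      = (\<integral>y. measure_pmf.prob (f y) A \<partial>measure_pmf p)"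
    by (simp add: integral_nonneg_AE)
  also have "\<dots> = (\<Sum>y\<in>S. measure_pmf.prob (f y) A * pmf p y)"
    using assms by (intro integral_measure_pmf_real) auto
  finally show ?thesis
    by (simp add: mult.commute)
qed

lemma steps_add: "steps K (s + t) x = bind_pmf (steps K s x) (steps K t)"
  by (induction t) (simp_all add: bind_return_pmf' bind_assoc_pmf)

text \<open>\<open>kernel_sym\<close> makes the uniform distribution stationary.
  \<open>holding\<close> gives period 1 at once and allows a path to be padded to any greater
  length.\<close>

locale symmetric_chain =
  fixes S :: "'s set" and K :: "'s \<Rightarrow> 's pmf"
  assumes chain: "markov_chain_on S K"
    and kernel_sym: "\<And>x y. x \<in> S \<Longrightarrow> y \<in> S \<Longrightarrow> pmf (K x) y = pmf (K y) x"
    and irreducible: "irreducible_on S K"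
    and holding: "\<And>x. x \<in> S \<Longrightarrow> x \<in> set_pmf (K x)"
begin

lemma finite_S: "finite S" and S_nonempty: "S \<noteq> {}"
  and closed: "x \<in> S \<Longrightarrow> set_pmf (K x) \<subseteq> S"
  using chain by (auto simp: markov_chain_on_def)

lemma steps_closed: "x \<in> S \<Longrightarrow> set_pmf (steps K t x) \<subseteq> S"
  by (induction t) (use closed in auto)

lemma holding_steps: "x \<in> S \<Longrightarrow> x \<in> set_pmf (steps K t x)"
  by (induction t) (use holding in auto)

lemma aperiodic: "aperiodic_on S K"
proof -
  have "Gcd {t. t \<ge> 1 \<and> pmf (steps K t x) x > 0} = 1" if "x \<in> S" for x
  proof -
    have "1 \<in> {t. t \<ge> 1 \<and> pmf (steps K t x) x > 0}"
      using holding_steps[OF that, of 1] by (simp add: pmf_positive_iff)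
    then show ?thesis
      by (metis Gcd_dvd nat_dvd_1_iff_1)
  qed
  then show ?thesis
    by (simp add: aperiodic_on_def)
qed

lemma ergodic: "ergodic_on S K"
  using irreducible aperiodic by (simp add: ergodic_on_def)

section \<open>Convergence to stationarity\<close>

text \<open>Doeblin's condition. Because states can hold, paths between all pairs of states can be
  padded to one common length; finiteness of \<open>S\<close> then gives a single positive lower
  bound.\<close>

lemma uniformly_positive_steps:
  "\<exists>T. \<exists>\<delta>>0. \<forall>x\<in>S. \<forall>y\<in>S. pmf (steps K T x) y \<ge> \<delta>"
proof -
  obtain \<tau> where \<tau>: "\<And>x y. x \<in> S \<Longrightarrow> y \<in> S \<Longrightarrow> y \<in> set_pmf (steps K (\<tau> x y) x)"
    using irreducible unfolding irreducible_on_def pmf_positive_iff by metis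
  \<comment> \<open>The sum serves only as a common upper bound for all the lengths
    \<open>\<tau> x y\<close>.\<close>
  define T where "T = (\<Sum>(x, y)\<in>S \<times> S. \<tau> x y)"
  have pos: "y \<in> set_pmf (steps K T x)" if "x \<in> S" "y \<in> S" for x y
  proof -
    have "\<tau> x y \<le> T"
      unfolding T_def using member_le_sum[of "(x, y)" "S \<times> S" "\<lambda>(x, y). \<tau> x y"] that finite_S
      by auto
    then have "steps K T x = bind_pmf (steps K (\<tau> x y) x) (steps K (T - \<tau> x y))"
      by (simp flip: steps_add)
    then show ?thesis
      using \<tau>[OF that] holding_steps[OF that(2)] by auto
  qed
  define \<delta> where "\<delta> = Min ((\<lambda>(x, y). pmf (steps K T x) y) ` (S \<times> S))"
  have "\<delta> > 0"
    unfolding \<delta>_def using finite_S S_nonempty pos by (subst Min_gr_iff) (auto simp: pmf_positive)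
  moreover have "pmf (steps K T x) y \<ge> \<delta>" if "x \<in> S" "y \<in> S" for x y
    unfolding \<delta>_def using finite_S that by (intro Min_le) auto
  ultimately show ?thesis
    by blast
qed

text \<open>The average from \<open>x\<close> gives weight at least \<delta> to a minimiser of
  \<open>f\<close>, so it is at most \<open>M - \<delta> * (M - m)\<close>, while the average from
  \<open>y\<close> is at least \<open>m\<close>. Averaging thus shrinks the oscillation by the
  factor \<open>1 - \<delta>\<close>.\<close>

lemma averaging_contracts:
  fixes f :: "'s \<Rightarrow> real"
  assumes minor: "\<And>x y. x \<in> S \<Longrightarrow> y \<in> S \<Longrightarrow> pmf (P x) y \<ge> \<delta>"
    and closedP: "\<And>x. x \<in> S \<Longrightarrow> set_pmf (P x) \<subseteq> S"
    and osc: "\<And>x y. x \<in> S \<Longrightarrow> y \<in> S \<Longrightarrow> f x - f y \<le> h"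
    and "0 \<le> \<delta>" "\<delta> \<le> 1" and x: "x \<in> S" and y: "y \<in> S"
  shows "(\<Sum>z\<in>S. pmf (P x) z * f z) - (\<Sum>z\<in>S. pmf (P y) z * f z) \<le> (1 - \<delta>) * h"
proof -
  define m where "m = Min (f ` S)"
  define M where "M = Max (f ` S)"
  have "m \<in> f ` S" "M \<in> f ` S"
    unfolding m_def M_def using finite_S S_nonempty by simp_all
  then obtain a b where ab: "a \<in> S" "b \<in> S" "f a = m" "f b = M"
    by auto
  have bounds: "m \<le> f z" "f z \<le> M" if "z \<in> S" for z
    unfolding m_def M_def using finite_S that by simp_all
  have total: "(\<Sum>z\<in>S. pmf (P w) z) = 1" if "w \<in> S" for w
    using closedP[OF that] finite_S by (rule sum_pmf_eq_1[rotated])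
  have "m = (\<Sum>z\<in>S. pmf (P y) z * m)"
    using total[OF y] by (simp flip: sum_distrib_right)
  also have "\<dots> \<le> (\<Sum>z\<in>S. pmf (P y) z * f z)"
    by (intro sum_mono mult_left_mono bounds) auto
  finally have lower: "m \<le> (\<Sum>z\<in>S. pmf (P y) z * f z)" .
  have "\<delta> * (M - m) \<le> pmf (P x) a * (M - f a)"
    using minor[OF x ab(1)] bounds[OF ab(1)] ab by (intro mult_mono) auto
  also have "\<dots> \<le> (\<Sum>z\<in>S. pmf (P x) z * (M - f z))"
    using bounds ab(1) finite_S by (intro member_le_sum) auto
  also have "\<dots> = M - (\<Sum>z\<in>S. pmf (P x) z * f z)"
    using total[OF x] by (simp add: right_diff_distrib sum_subtractf flip: sum_distrib_right)
  finally have "(\<Sum>z\<in>S. pmf (P x) z * f z) - m \<le> (1 - \<delta>) * (M - m)"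
    by (simp add: algebra_simps)
  also have "\<dots> \<le> (1 - \<delta>) * h"
    using osc[OF ab(2,1)] ab \<open>\<delta> \<le> 1\<close> by (intro mult_left_mono) auto
  finally show ?thesis
    using lower by linarith
qed

lemma forgets_start:
  assumes "\<epsilon> > 0"
  obtains t where
    "\<And>x y A. x \<in> S \<Longrightarrow> y \<in> S \<Longrightarrow>
      measure_pmf.prob (steps K t x) A - measure_pmf.prob (steps K t y) A \<le> \<epsilon>"
proof -
  obtain T \<delta>' where \<delta>': "\<delta>' > 0" "\<And>x y. x \<in> S \<Longrightarrow> y \<in> S \<Longrightarrow> pmf (steps K T x) y \<ge> \<delta>'"
    using uniformly_positive_steps by meson
  define \<delta> where "\<delta> = min \<delta>' 1"
  have \<delta>: "0 < \<delta>" "\<delta> \<le> 1" "\<And>x y. x \<in> S \<Longrightarrow> y \<in> S \<Longrightarrow> pmf (steps K T x) y \<ge> \<delta>"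
    unfolding \<delta>_def using \<delta>' by (auto simp: min_le_iff_disj)
  have contract: "measure_pmf.prob (steps K (T * j) x) A - measure_pmf.prob (steps K (T * j) y) A
      \<le> (1 - \<delta>) ^ j" if "x \<in> S" "y \<in> S" for x y A j
    using that
  proof (induction j arbitrary: x y)
    case 0
    have "measure_pmf.prob (steps K (T * 0) x) A \<le> 1" "measure_pmf.prob (steps K (T * 0) y) A \<ge> 0"
      by (rule measure_pmf.prob_le_1 measure_nonneg)+
    then show ?case
      unfolding power_0 by linarith
  next
    case (Suc j)
    \<comment> \<open>Splitting off the first \<open>T\<close> steps exhibits the probability as an
      average of the probabilities after \<open>T * j\<close> steps, so one more contraction
      applies.\<close>
    have "measure_pmf.prob (steps K (T * Suc j) w) A
        = (\<Sum>z\<in>S. pmf (steps K T w) z * measure_pmf.prob (steps K (T * j) z) A)"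
      if "w \<in> S" for w
      using prob_bind_pmf_finite[OF finite_S steps_closed[OF that]] by (simp add: steps_add)
    then show ?case
      using averaging_contracts[where P = "steps K T", OF \<delta>(3) steps_closed Suc.IH] \<delta>(1,2) Suc.prems
      by simp
  qed
  have "(\<lambda>j. (1 - \<delta>) ^ j) \<longlonglongrightarrow> 0"
    using \<delta> by (intro LIMSEQ_realpow_zero) auto
  then have "\<forall>\<^sub>F j in sequentially. (1 - \<delta>) ^ j < \<epsilon>"
    using \<open>\<epsilon> > 0\<close> by (rule order_tendstoD)
  then obtain j where "(1 - \<delta>) ^ j < \<epsilon>"
    by (auto simp: eventually_sequentially)
  then show thesis
    using that[of "T * j"] contract[of _ _ j] by (meson less_imp_le order_trans)
qed

lemma stationary_steps: "stationary_on S K \<pi> \<Longrightarrow> bind_pmf \<pi> (steps K t) = \<pi>"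
proof (induction t)
  case 0
  have "steps K 0 = return_pmf"
    by (rule ext) simp
  then show ?case
    by (simp add: bind_return_pmf')
next
  case (Suc t)
  have "steps K (Suc t) = (\<lambda>x. bind_pmf (steps K t x) K)"
    by (rule ext) simp
  then show ?case
    using Suc by (simp add: stationary_on_def flip: bind_assoc_pmf)
qed

text \<open>By invariance \<pi> gives \<open>A\<close> the \<pi>-average of the probabilities after
  \<open>t\<close> steps, and a bound on the difference between any two starts passes to this
  average.\<close>

lemma stationary_close_to_steps:
  assumes \<pi>: "stationary_on S K \<pi>" and x: "x \<in> S"
    and t: "\<And>x y A. x \<in> S \<Longrightarrow> y \<in> S \<Longrightarrow>
      measure_pmf.prob (steps K t x) A - measure_pmf.prob (steps K t y) A \<le> \<epsilon>"
  shows "\<bar>measure_pmf.prob (steps K t x) A - measure_pmf.prob \<pi> A\<bar> \<le> \<epsilon>"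
proof -
  have \<pi>S: "set_pmf \<pi> \<subseteq> S"
    using \<pi> by (simp add: stationary_on_def)
  define p where "p y = measure_pmf.prob (steps K t y) A" for y
  have avg: "measure_pmf.prob \<pi> A = (\<Sum>y\<in>S. pmf \<pi> y * p y)"
    using prob_bind_pmf_finite[OF finite_S \<pi>S, of "steps K t" A] stationary_steps[OF \<pi>]
    by (simp add: p_def)
  have one: "(\<Sum>y\<in>S. pmf \<pi> y) = 1"
    by (rule sum_pmf_eq_1[OF finite_S \<pi>S])
  have "p x - measure_pmf.prob \<pi> A = (\<Sum>y\<in>S. pmf \<pi> y * (p x - p y))"
    unfolding avg using one by (simp add: right_diff_distrib sum_subtractf flip: sum_distrib_right)
  also have "\<bar>\<dots>\<bar> \<le> (\<Sum>y\<in>S. pmf \<pi> y * \<bar>p x - p y\<bar>)"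
    by (rule order_trans[OF sum_abs]) (simp add: abs_mult)
  also have "\<dots> \<le> (\<Sum>y\<in>S. pmf \<pi> y * \<epsilon>)"
  proof (intro sum_mono mult_left_mono)
    fix y assume "y \<in> S"
    then show "\<bar>p x - p y\<bar> \<le> \<epsilon>"
      using t[OF x, of y A] t[OF _ x, of y A] by (simp add: p_def abs_le_iff)
  qed simp
  also have "\<dots> = \<epsilon>"
    using one by (simp flip: sum_distrib_right)
  finally show ?thesis
    by (simp add: p_def)
qed

text \<open>Both distributions are within any \<epsilon> / 2 of the same \<open>steps K t x\<close>.
  This gives meaning to the \<open>THE\<close> in \<open>stationary_distribution\<close>.\<close>

lemma stationary_unique:
  assumes "stationary_on S K \<pi>" and "stationary_on S K \<rho>"
  shows "\<pi> = \<rho>"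
proof (rule pmf_eqI)
  fix y
  obtain x where x: "x \<in> S"
    using S_nonempty by auto
  have "\<bar>pmf \<pi> y - pmf \<rho> y\<bar> \<le> \<epsilon>" if "\<epsilon> > 0" for \<epsilon>
  proof -
    obtain t where t: "\<And>x y A. x \<in> S \<Longrightarrow> y \<in> S \<Longrightarrow>
        measure_pmf.prob (steps K t x) A - measure_pmf.prob (steps K t y) A \<le> \<epsilon> / 2"
      using forgets_start[of "\<epsilon> / 2"] \<open>\<epsilon> > 0\<close> by auto
    show ?thesis
      using stationary_close_to_steps[OF assms(1) x t, of "{y}"]
        stationary_close_to_steps[OF assms(2) x t, of "{y}"]
      unfolding measure_pmf_single by linarith
  qed
  then have "\<bar>pmf \<pi> y - pmf \<rho> y\<bar> \<le> 0"
    by (meson field_le_epsilon add_0 order_trans dense_ge)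
  then show "pmf \<pi> y = pmf \<rho> y"
    by simp
qed

text \<open>Symmetry turns the column sums of the transition matrix into row sums, which are
  1.\<close>

lemma uniform_stationary: "stationary_on S K (pmf_of_set S)"
proof -
  note [simp] = finite_S S_nonempty
  have "bind_pmf (pmf_of_set S) K = pmf_of_set S"
  proof (rule pmf_eqI)
    fix y
    have "pmf (bind_pmf (pmf_of_set S) K) y = (\<Sum>x\<in>S. pmf (K x) y) / card S"
      by (simp add: pmf_bind integral_pmf_of_set)
    also have "\<dots> = indicator S y / card S"
    proof (cases "y \<in> S")
      case True
      then have "(\<Sum>x\<in>S. pmf (K x) y) = (\<Sum>x\<in>S. pmf (K y) x)"
        by (intro sum.cong kernel_sym) auto
      also have "\<dots> = 1"
        using True by (intro sum_pmf_eq_1 closed) simp_all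
      finally show ?thesis
        using True by simp
    next
      case False
      then have "pmf (K x) y = 0" if "x \<in> S" for x
        using closed[OF that] by (auto simp: pmf_eq_0_set_pmf)
      then show ?thesis
        using False by simp
    qed
    finally show "pmf (bind_pmf (pmf_of_set S) K) y = pmf (pmf_of_set S) y"
      by simp
  qed
  then show ?thesis
    by (simp add: stationary_on_def)
qed

lemma stationary_distribution_eq: "stationary_distribution S K = pmf_of_set S"
  unfolding stationary_distribution_def
  using uniform_stationary stationary_unique by (intro the_equality) auto

lemma dist_to_stationarity_le_iff:
  "dist_to_stationarity S K t \<le> \<epsilon> \<longleftrightarrow>
    (\<forall>x\<in>S. \<forall>A\<subseteq>S. \<bar>measure_pmf.prob (steps K t x) A - measure_pmf.prob (pmf_of_set S) A\<bar> \<le> \<epsilon>)"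
proof -
  have "tv_dist S \<mu> \<nu> \<le> \<epsilon> \<longleftrightarrow>
      (\<forall>A\<subseteq>S. \<bar>measure_pmf.prob \<mu> A - measure_pmf.prob \<nu> A\<bar> \<le> \<epsilon>)" for \<mu> \<nu>
    unfolding tv_dist_def using finite_S by (subst Max_le_iff) auto
  then show ?thesis
    unfolding dist_to_stationarity_def stationary_distribution_eq
    using finite_S S_nonempty by (subst Max_le_iff) auto
qed

text \<open>
  The \<open>LEAST\<close> in the definition of the mixing time ranges over a nonempty set of times; without that
  nothing could be said about it.
\<close>

lemma close_at_mixing_time:
  assumes "x \<in> S" and "A \<subseteq> S"
  shows "\<bar>measure_pmf.prob (steps K (mixing_time S K) x) A - measure_pmf.prob (pmf_of_set S) A\<bar>
    \<le> 1 / 4"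
proof -
  obtain t where "\<And>x y A. x \<in> S \<Longrightarrow> y \<in> S \<Longrightarrow>
      measure_pmf.prob (steps K t x) A - measure_pmf.prob (steps K t y) A \<le> 1 / 4"
    using forgets_start[of "1 / 4"] by auto
  then have "dist_to_stationarity S K t \<le> 1 / 4"
    unfolding dist_to_stationarity_le_iff
    using stationary_close_to_steps[OF uniform_stationary] by blast
  then have "dist_to_stationarity S K (mixing_time S K) \<le> 1 / 4"
    unfolding mixing_time_def by (rule LeastI)
  then show ?thesis
    using assms unfolding dist_to_stationarity_le_iff by blast
qed

end

section \<open>Glauber dynamics on non-frozen colourings\<close>

text \<open>The choice \<open>c = \<alpha> v\<close> is allowed, so a step may change nothing; all
  other steps on a \<open>pair_graph\<close> are the edges of the recolouring graph.\<close>

definition recolours :: "'v pair_pre_digraph \<Rightarrow> nat \<Rightarrow> ('v \<Rightarrow> nat) \<Rightarrow> ('v \<Rightarrow> nat) \<Rightarrow> bool" where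
  "recolours G q \<alpha> \<beta> \<longleftrightarrow> \<alpha> \<in> colourings G q \<and>
    (\<exists>v\<in>pverts G. \<exists>c\<in>{1..q}. c \<notin> \<alpha> ` neighbourhood G v \<and> \<beta> = \<alpha>(v := c))"

abbreviation nonfrozen :: "'v pair_pre_digraph \<Rightarrow> nat \<Rightarrow> ('v \<Rightarrow> nat) set" where
  "nonfrozen G q \<equiv> colourings G q - frozen_colourings G q"

text \<open>The deterministic part of a Glauber step. Separating it from the random draw allows the
  effect on damage to be bounded draw by draw.\<close>

definition recolour_choice ::
  "'v pair_pre_digraph \<Rightarrow> ('v \<Rightarrow> nat) \<Rightarrow> 'v \<times> nat \<Rightarrow> 'v \<Rightarrow> nat" where
  "recolour_choice G \<alpha> = (\<lambda>(v, c). if c \<notin> \<alpha> ` neighbourhood G v then \<alpha>(v := c) else \<alpha>)"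

locale colouring_dynamics = pair_graph G for G :: "'v pair_pre_digraph" +
  fixes q :: nat
  assumes verts_nonempty: "pverts G \<noteq> {}" and colours_nonempty: "q \<ge> 1"
begin

lemma colourings_range: "\<alpha> \<in> colourings G q \<Longrightarrow> v \<in> pverts G \<Longrightarrow> \<alpha> v \<in> {1..q}"
  unfolding colourings_def by fastforce

lemma colourings_proper: "\<alpha> \<in> colourings G q \<Longrightarrow> (x, y) \<in> parcs G \<Longrightarrow> \<alpha> x \<noteq> \<alpha> y"
  by (auto simp: colourings_def)

lemma finite_colourings: "finite (colourings G q)"
  by (rule finite_subset[of _ "pverts G \<rightarrow>\<^sub>E {1..q}"])
    (auto simp: colourings_def intro!: finite_PiE pair_finite_verts)

lemma fun_upd_colouring:
  assumes "\<alpha> \<in> colourings G q" "v \<in> pverts G" "c \<in> {1..q}" "c \<notin> \<alpha> ` neighbourhood G v"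
  shows "\<alpha>(v := c) \<in> colourings G q"
proof -
  have "\<alpha>(v := c) \<in> pverts G \<rightarrow>\<^sub>E {1..q}"
    using assms(1-3) unfolding colourings_def by (auto simp: PiE_iff extensional_def)
  moreover have "(\<alpha>(v := c)) x \<noteq> (\<alpha>(v := c)) y" if "(x, y) \<in> parcs G" for x y
    using that arcs_symmetric[OF that] pair_no_loops[OF that] assms(4) colourings_proper[OF assms(1) that]
    by (auto simp: neighbourhood_def)
  ultimately show ?thesis
    by (simp add: colourings_def)
qed

lemma self_not_in_neighbourhood: "v \<notin> neighbourhood G v"
  using pair_no_loops[of "(v, v)"] by (auto simp: neighbourhood_def)

lemma own_colour_available: "\<alpha> \<in> colourings G q \<Longrightarrow> \<alpha> v \<notin> \<alpha> ` neighbourhood G v"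
  using colourings_proper[of \<alpha> v] by (fastforce simp: neighbourhood_def)

lemma recolours_colouring: "recolours G q \<alpha> \<beta> \<Longrightarrow> \<beta> \<in> colourings G q"
  unfolding recolours_def using fun_upd_colouring by auto

text \<open>Recolouring \<open>v\<close> leaves its neighbours alone, so the old colour of
  \<open>v\<close> stays available.\<close>

lemma recolours_sym:
  assumes "recolours G q \<alpha> \<beta>"
  shows "recolours G q \<beta> \<alpha>"
proof -
  obtain v c where vc: "\<alpha> \<in> colourings G q" "v \<in> pverts G" "\<beta> = \<alpha>(v := c)"
    using assms by (auto simp: recolours_def)
  have "\<alpha> v \<notin> \<beta> ` neighbourhood G v"
    using own_colour_available[OF vc(1), of v] self_not_in_neighbourhood[of v] vc(3) by auto
  moreover have "\<alpha> = \<beta>(v := \<alpha> v)"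
    using vc(3) by simp
  ultimately show ?thesis
    using recolours_colouring[OF assms] vc colourings_range[OF vc(1,2)]
    unfolding recolours_def by blast
qed

lemma rtranclp_recolours_sym:
  "(recolours G q)\<^sup>*\<^sup>* \<alpha> \<beta> \<Longrightarrow> (recolours G q)\<^sup>*\<^sup>* \<beta> \<alpha>"
  by (metis recolours_sym sympI symp_rtranclp sympD)

lemma glauber_eq: "glauber G q \<alpha> = map_pmf (recolour_choice G \<alpha>) (pmf_of_set (pverts G \<times> {1..q}))"
proof -
  have "pair_pmf (pmf_of_set (pverts G)) (pmf_of_set {1..q}) = pmf_of_set (pverts G \<times> {1..q})"
    using colours_nonempty
    by (intro pmf_eqI) (simp add: split_paired_all pmf_pair verts_nonempty pair_finite_verts
        card_cartesian_product indicator_times)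
  then show ?thesis
    by (simp add: glauber_def recolour_choice_def)
qed

lemma set_pmf_choice: "set_pmf (pmf_of_set (pverts G \<times> {1..q})) = pverts G \<times> {1..q}"
  using verts_nonempty colours_nonempty pair_finite_verts by (intro set_pmf_of_set) auto

lemma set_pmf_glauber:
  assumes "\<alpha> \<in> colourings G q"
  shows "set_pmf (glauber G q \<alpha>) = insert \<alpha> {\<beta>. recolours G q \<alpha> \<beta>}"
proof -
  obtain v where v: "v \<in> pverts G"
    using verts_nonempty by auto
  have "\<alpha> = recolour_choice G \<alpha> (v, \<alpha> v)"
    by (simp add: recolour_choice_def)
  then have "\<alpha> \<in> recolour_choice G \<alpha> ` (pverts G \<times> {1..q})"
    using v colourings_range[OF assms v] by blast
  moreover have "\<beta> \<in> recolour_choice G \<alpha> ` (pverts G \<times> {1..q})" if "recolours G q \<alpha> \<beta>" for \<beta>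
  proof -
    obtain w c where wc: "w \<in> pverts G" "c \<in> {1..q}"
        "c \<notin> \<alpha> ` neighbourhood G w" "\<beta> = \<alpha>(w := c)"
      using \<open>recolours G q \<alpha> \<beta>\<close> unfolding recolours_def by blast
    then have "\<beta> = recolour_choice G \<alpha> (w, c)"
      by (simp add: recolour_choice_def)
    then show ?thesis
      using wc(1,2) by blast
  qed
  moreover have "\<beta> = \<alpha> \<or> recolours G q \<alpha> \<beta>"
    if "\<beta> \<in> recolour_choice G \<alpha> ` (pverts G \<times> {1..q})" for \<beta>
  proof -
    obtain w c where wc: "w \<in> pverts G" "c \<in> {1..q}" "\<beta> = recolour_choice G \<alpha> (w, c)"
      using \<open>\<beta> \<in> _\<close> by blast
    then show ?thesis
    proof (cases "c \<in> \<alpha> ` neighbourhood G w")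
      case True
      then show ?thesis
        using wc(3) by (simp add: recolour_choice_def)
    next
      case False
      then have "\<beta> = \<alpha>(w := c)"
        using wc(3) by (simp add: recolour_choice_def)
      then show ?thesis
        unfolding recolours_def using assms wc(1,2) False by blast
    qed
  qed
  ultimately show ?thesis
    unfolding glauber_eq set_map_pmf set_pmf_choice by blast
qed

text \<open>Exactly one draw \<open>(v, c)\<close> leads from \<alpha> to a different \<beta> when
  such a step exists. The value depends only on the symmetric relation \<open>recolours\<close>,
  hence \<open>glauber_sym\<close>.\<close>

lemma pmf_glauber_neq:
  assumes \<alpha>: "\<alpha> \<in> colourings G q" and neq: "\<beta> \<noteq> \<alpha>"
  shows "pmf (glauber G q \<alpha>) \<beta> =
    (if recolours G q \<alpha> \<beta> then 1 / (card (pverts G) * q) else 0)"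
proof (cases "recolours G q \<alpha> \<beta>")
  case True
  then obtain v c where vc: "v \<in> pverts G" "c \<in> {1..q}" "c \<notin> \<alpha> ` neighbourhood G v" "\<beta> = \<alpha>(v := c)"
    by (auto simp: recolours_def)
  have "recolour_choice G \<alpha> p = \<beta> \<longleftrightarrow> p = (v, c)" for p
    using vc(3,4) neq by (auto simp: recolour_choice_def fun_eq_iff split: prod.split if_splits)
  then have "(pverts G \<times> {1..q}) \<inter> recolour_choice G \<alpha> -` {\<beta>} = {(v, c)}"
    using vc by auto
  then show ?thesis
    using True verts_nonempty colours_nonempty pair_finite_verts
    by (simp add: glauber_eq pmf_map measure_pmf_of_set card_cartesian_product)
next
  case False
  then show ?thesis
    using set_pmf_glauber[OF \<alpha>] neq by (simp add: pmf_eq_0_set_pmf)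
qed

lemma glauber_sym:
  assumes "\<alpha> \<in> colourings G q" "\<beta> \<in> colourings G q"
  shows "pmf (glauber G q \<alpha>) \<beta> = pmf (glauber G q \<beta>) \<alpha>"
  by (cases "\<beta> = \<alpha>") (use assms recolours_sym[of \<alpha> \<beta>] recolours_sym[of \<beta> \<alpha>] in \<open>auto simp: pmf_glauber_neq\<close>)

lemma nonfrozen_iff:
  "\<alpha> \<in> nonfrozen G q \<longleftrightarrow> \<alpha> \<in> colourings G q \<and>
    (\<exists>v\<in>pverts G. \<exists>c\<in>{1..q}. c \<noteq> \<alpha> v \<and> c \<notin> \<alpha> ` neighbourhood G v)"
  unfolding frozen_colourings_def by (simp add: subset_eq Bex_def) blast

lemma nonfrozen_if_recolours:
  assumes "recolours G q \<alpha> \<beta>" "\<alpha> \<noteq> \<beta>"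
  shows "\<alpha> \<in> nonfrozen G q"
proof -
  obtain v c where vc: "\<alpha> \<in> colourings G q" "v \<in> pverts G" "c \<in> {1..q}"
      "c \<notin> \<alpha> ` neighbourhood G v" "\<beta> = \<alpha>(v := c)"
    using assms(1) by (auto simp: recolours_def)
  have "c \<noteq> \<alpha> v"
    using vc(5) assms(2) by auto
  then show ?thesis
    unfolding nonfrozen_iff using vc(1-4) by blast
qed

text \<open>A colouring reached by an actual change can change back, so it is not frozen.\<close>

lemma set_pmf_glauber_nonfrozen:
  assumes "\<alpha> \<in> nonfrozen G q"
  shows "set_pmf (glauber G q \<alpha>) \<subseteq> nonfrozen G q"
proof
  fix \<beta> assume "\<beta> \<in> set_pmf (glauber G q \<alpha>)"
  then have "\<beta> = \<alpha> \<or> recolours G q \<alpha> \<beta>"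
    using assms set_pmf_glauber by auto
  then show "\<beta> \<in> nonfrozen G q"
    using assms nonfrozen_if_recolours[OF recolours_sym, of \<alpha> \<beta>] by (cases "\<beta> = \<alpha>") auto
qed

lemma rtranclp_recolours_steps:
  assumes "(recolours G q)\<^sup>*\<^sup>* \<alpha> \<beta>" and "\<alpha> \<in> colourings G q"
  shows "\<exists>t. \<beta> \<in> set_pmf (steps (glauber G q) t \<alpha>)"
  using assms
proof (induction rule: rtranclp_induct)
  case base
  have "\<alpha> \<in> set_pmf (steps (glauber G q) 0 \<alpha>)"
    by simp
  then show ?case
    by blast
next
  case (step \<beta> \<gamma>)
  then obtain t where "\<beta> \<in> set_pmf (steps (glauber G q) t \<alpha>)"
    by blast
  moreover have "\<gamma> \<in> set_pmf (glauber G q \<beta>)"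
    using step by (subst set_pmf_glauber) (auto simp: recolours_def)
  ultimately have "\<gamma> \<in> set_pmf (steps (glauber G q) (Suc t) \<alpha>)"
    by auto
  then show ?case
    by blast
qed

lemma symmetric_chain_nonfrozen:
  assumes "nonfrozen G q \<noteq> {}"
    and connected: "\<And>\<alpha> \<beta>. \<alpha> \<in> nonfrozen G q \<Longrightarrow> \<beta> \<in> nonfrozen G q \<Longrightarrow> (recolours G q)\<^sup>*\<^sup>* \<alpha> \<beta>"
  shows "symmetric_chain (nonfrozen G q) (glauber G q)"
proof
  show "markov_chain_on (nonfrozen G q) (glauber G q)"
    unfolding markov_chain_on_def
    using finite_colourings assms(1) set_pmf_glauber_nonfrozen by blast
  show "irreducible_on (nonfrozen G q) (glauber G q)"
    unfolding irreducible_on_def pmf_positive_iff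
    using connected rtranclp_recolours_steps by blast
qed (auto simp: set_pmf_glauber glauber_sym)

section \<open>Symmetry under permutations of the colours\<close>

lemma permute_colours:
  assumes \<sigma>: "\<sigma> permutes {1..q}" and "\<alpha> \<in> nonfrozen G q"
  shows "restrict (\<sigma> \<circ> \<alpha>) (pverts G) \<in> nonfrozen G q"
proof -
  let ?\<beta> = "restrict (\<sigma> \<circ> \<alpha>) (pverts G)"
  have \<alpha>: "\<alpha> \<in> colourings G q"
    using assms(2) by simp
  obtain v c where v: "v \<in> pverts G" "c \<in> {1..q}" "c \<noteq> \<alpha> v" "c \<notin> \<alpha> ` neighbourhood G v"
    using assms(2) unfolding nonfrozen_iff by blast
  have "?\<beta> \<in> pverts G \<rightarrow>\<^sub>E {1..q}"
    using colourings_range[OF \<alpha>] permutes_in_image[OF \<sigma>] by auto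
  moreover have "?\<beta> x \<noteq> ?\<beta> y" if "(x, y) \<in> parcs G" for x y
    using in_arcsD1[OF that] in_arcsD2[OF that] colourings_proper[OF \<alpha> that] permutes_inj[OF \<sigma>]
    by (auto dest: injD)
  ultimately have "?\<beta> \<in> colourings G q"
    by (simp add: colourings_def)
  moreover have "\<sigma> c \<notin> ?\<beta> ` neighbourhood G v"
  proof -
    have "neighbourhood G v \<subseteq> pverts G"
      using in_arcsD2 by (auto simp: neighbourhood_def)
    then have "?\<beta> ` neighbourhood G v = \<sigma> ` \<alpha> ` neighbourhood G v"
      unfolding image_image by (intro image_cong) auto
    then show ?thesis
      using v(4) permutes_inj[OF \<sigma>] by (metis inj_image_mem_iff)
  qed
  moreover have "\<sigma> c \<noteq> ?\<beta> v"
    using v(1,3) permutes_inj[OF \<sigma>] by (auto dest: injD)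
  moreover have "\<sigma> c \<in> {1..q}"
    using v(2) permutes_in_image[OF \<sigma>] by blast
  ultimately show ?thesis
    unfolding nonfrozen_iff using v(1) by blast
qed

text \<open>Swapping \<open>c\<close> and \<open>d\<close> injects the colourings with
  \<open>c\<close> at \<open>v\<close> into those with \<open>d\<close> at \<open>v\<close>, and
  these classes are disjoint for different \<open>d\<close>. Under the uniform distribution,
  \<open>v\<close> therefore has colour \<open>c\<close> with probability at most
  \<open>1 / q\<close>.\<close>

lemma colour_symmetry:
  assumes v: "v \<in> pverts G" and c: "c \<in> {1..q}"
  shows "q * card {\<alpha> \<in> nonfrozen G q. \<alpha> v = c} \<le> card (nonfrozen G q)"
proof -
  define A where "A d = {\<alpha> \<in> nonfrozen G q. \<alpha> v = d}" for d
  have fin: "finite (A d)" for d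
    using finite_colourings by (simp add: A_def)
  have le: "card (A c) \<le> card (A d)" if d: "d \<in> {1..q}" for d
  proof (rule card_inj_on_le)
    let ?\<sigma> = "Transposition.transpose c d"
    have \<sigma>: "?\<sigma> permutes {1..q}"
      using c d by (rule permutes_swap_id)
    let ?f = "\<lambda>\<alpha>. restrict (?\<sigma> \<circ> \<alpha>) (pverts G)"
    show "inj_on ?f (A c)"
    proof (rule inj_onI, rule ext)
      fix \<alpha> \<beta> x
      assume *: "\<alpha> \<in> A c" "\<beta> \<in> A c" "?f \<alpha> = ?f \<beta>"
      show "\<alpha> x = \<beta> x"
      proof (cases "x \<in> pverts G")
        case True
        then show ?thesis
          using fun_cong[OF *(3), of x] by (simp add: inj_eq[OF permutes_inj[OF \<sigma>]])
      next
        case False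
        then show ?thesis
          using *(1,2) by (auto simp: A_def colourings_def PiE_iff extensional_def)
      qed
    qed
    show "?f ` A c \<subseteq> A d"
    proof (rule image_subsetI)
      fix \<alpha> assume "\<alpha> \<in> A c"
      then have \<alpha>: "\<alpha> \<in> nonfrozen G q" "\<alpha> v = c"
        by (simp_all only: A_def mem_Collect_eq)
      have "?f \<alpha> v = d"
        using v \<alpha>(2) by simp
      then show "?f \<alpha> \<in> A d"
        unfolding A_def using permute_colours[OF \<sigma> \<alpha>(1)] by blast
    qed
  qed (rule fin)
  have "q * card (A c) = (\<Sum>d\<in>{1..q}. card (A c))"
    by simp
  also have "\<dots> \<le> (\<Sum>d\<in>{1..q}. card (A d))"
    by (intro sum_mono le)
  also have "\<dots> = card (\<Union>d\<in>{1..q}. A d)"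
  proof (rule card_UN_disjoint[symmetric])
    show "\<forall>d\<in>{1..q}. \<forall>d'\<in>{1..q}. d \<noteq> d' \<longrightarrow> A d \<inter> A d' = {}"
      unfolding A_def by blast
  qed (simp_all add: fin)
  also have "\<dots> \<le> card (nonfrozen G q)"
  proof (rule card_mono)
    show "(\<Union>d\<in>{1..q}. A d) \<subseteq> nonfrozen G q"
      unfolding A_def by blast
  qed (simp add: finite_colourings)
  finally show ?thesis
    by (simp add: A_def)
qed

end

section \<open>A necklace of cliques\<close>

locale necklace =
  fixes \<Delta> k :: nat
  assumes \<Delta>: "\<Delta> \<ge> 3" and k: "k \<ge> 5"
begin

abbreviation "m \<equiv> 2 * k"

text \<open>Position \<open>j\<close> of block \<open>i\<close>. Blocks are consecutive intervals of
  labels, and \<open>Suc\<close> makes the labels start at 1.\<close>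

definition vtx :: "nat \<Rightarrow> nat \<Rightarrow> nat" where
  "vtx i j = Suc (i * Suc \<Delta> + j)"

definition nxt :: "nat \<Rightarrow> nat" where
  "nxt i = (if Suc i = m then 0 else Suc i)"

definition prv :: "nat \<Rightarrow> nat" where
  "prv i = (if i = 0 then m - 1 else i - 1)"

text \<open>
  A block is the clique on its positions \<open>0, \<dots>, \<Delta>\<close> without the edge between \<open>0\<close> and \<open>\<Delta>\<close>; position \<open>\<Delta>\<close> is
  joined to position \<open>0\<close> of the next block instead.
\<close>

definition adj :: "nat \<Rightarrow> nat \<Rightarrow> nat \<Rightarrow> nat \<Rightarrow> bool" where
  "adj i j i' j' \<longleftrightarrow>
    i = i' \<and> j \<noteq> j' \<and> (j, j') \<noteq> (0, \<Delta>) \<and> (j, j') \<noteq> (\<Delta>, 0)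
    \<or> j = \<Delta> \<and> j' = 0 \<and> i' = nxt i \<or> j = 0 \<and> j' = \<Delta> \<and> i = nxt i'"

definition G :: "nat pair_pre_digraph" where
  "G = \<lparr> pverts = {1..m * Suc \<Delta>},
     parcs = {(vtx i j, vtx i' j') | i j i' j'. i < m \<and> j \<le> \<Delta> \<and> i' < m \<and> j' \<le> \<Delta> \<and> adj i j i' j'} \<rparr>"

lemma nxt_less [simp]: "i < m \<Longrightarrow> nxt i < m"
  and prv_less [simp]: "i < m \<Longrightarrow> prv i < m"
  and nxt_neq [simp]: "nxt i \<noteq> i"
  and prv_neq [simp]: "i < m \<Longrightarrow> prv i \<noteq> i"
  and prv_nxt [simp]: "i < m \<Longrightarrow> prv (nxt i) = i"
  and nxt_prv [simp]: "i < m \<Longrightarrow> nxt (prv i) = i"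
  using k by (auto simp: nxt_def prv_def)

lemma vtx_eq_iff [simp]: "j \<le> \<Delta> \<Longrightarrow> j' \<le> \<Delta> \<Longrightarrow> vtx i j = vtx i' j' \<longleftrightarrow> i = i' \<and> j = j'"
proof
  assume j: "j \<le> \<Delta>" "j' \<le> \<Delta>" and "vtx i j = vtx i' j'"
  then have eq: "i * Suc \<Delta> + j = i' * Suc \<Delta> + j'"
    by (simp add: vtx_def)
  have "(i * Suc \<Delta> + j) div Suc \<Delta> = i" "(i' * Suc \<Delta> + j') div Suc \<Delta> = i'"
    using j by (simp_all del: mult_Suc_right)
  then have "i = i'"
    using eq by metis
  then show "i = i' \<and> j = j'"
    using eq by simp
qed simp

lemma verts_eq: "pverts G = {vtx i j | i j. i < m \<and> j \<le> \<Delta>}"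
proof (intro equalityI subsetI)
  fix x assume "x \<in> pverts G"
  then have x: "x \<ge> 1" "x - 1 < m * Suc \<Delta>"
    by (auto simp: G_def)
  have "x = vtx ((x - 1) div Suc \<Delta>) ((x - 1) mod Suc \<Delta>)"
    using x(1) div_mult_mod_eq[of "x - 1" "Suc \<Delta>"] by (simp add: vtx_def del: mult_Suc_right)
  moreover have "(x - 1) div Suc \<Delta> < m"
    using x(2) by (simp add: less_mult_imp_div_less)
  moreover have "(x - 1) mod Suc \<Delta> \<le> \<Delta>"
    by (simp add: less_Suc_eq_le[symmetric])
  ultimately show "x \<in> {vtx i j | i j. i < m \<and> j \<le> \<Delta>}"
    by blast
next
  fix x assume "x \<in> {vtx i j | i j. i < m \<and> j \<le> \<Delta>}"
  then obtain i j where ij: "x = vtx i j" "i < m" "j \<le> \<Delta>"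
    by blast
  have "i * Suc \<Delta> + j < Suc i * Suc \<Delta>"
    using ij(3) by simp
  also have "\<dots> \<le> m * Suc \<Delta>"
    using ij(2) by (intro mult_right_mono) auto
  finally show "x \<in> pverts G"
    by (simp add: ij(1) vtx_def G_def)
qed

lemma vtx_in_verts [simp]: "i < m \<Longrightarrow> j \<le> \<Delta> \<Longrightarrow> vtx i j \<in> pverts G"
  by (auto simp: verts_eq)

lemma finite_verts: "finite (pverts G)"
  by (simp add: G_def)

lemma adj_sym: "adj i j i' j' \<longleftrightarrow> adj i' j' i j"
  unfolding adj_def by auto

lemma adj_irrefl: "\<not> adj i j i j"
  using \<Delta> by (auto simp: adj_def)

lemma arcs_eq:
  "parcs G = {(vtx i j, vtx i' j') | i j i' j'. i < m \<and> j \<le> \<Delta> \<and> i' < m \<and> j' \<le> \<Delta> \<and> adj i j i' j'}"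
  by (simp add: G_def)

lemma pair_graph_G: "pair_graph G"
proof -
  have sub: "parcs G \<subseteq> pverts G \<times> pverts G"
    unfolding arcs_eq by auto
  show ?thesis
  proof
    show "finite (parcs G)"
      by (rule finite_subset[OF sub]) (simp add: finite_verts)
    show "symmetric (with_proj G)"
      unfolding symmetric_def with_proj_simps arcs_eq by (rule symI) (use adj_sym in blast)
    fix e assume "e \<in> parcs G"
    then show "fst e \<in> pverts G" "snd e \<in> pverts G" "fst e \<noteq> snd e"
      using sub adj_irrefl by (auto simp: arcs_eq)
  qed (rule finite_verts)
qed

sublocale colouring_dynamics G "Suc \<Delta>"
proof -
  interpret pair_graph G
    by (rule pair_graph_G)
  show "colouring_dynamics G (Suc \<Delta>)"
    by unfold_locales (use k \<Delta> in \<open>auto simp: G_def\<close>)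
qed

lemma arc_iff:
  assumes "i < m" "j \<le> \<Delta>" "i' < m" "j' \<le> \<Delta>"
  shows "(vtx i j, vtx i' j') \<in> parcs G \<longleftrightarrow> adj i j i' j'"
proof
  assume "(vtx i j, vtx i' j') \<in> parcs G"
  then show "adj i j i' j'"
    using assms unfolding arcs_eq by auto
next
  assume "adj i j i' j'"
  then show "(vtx i j, vtx i' j') \<in> parcs G"
    using assms unfolding arcs_eq by blast
qed

lemma vtx_in_image_iff [simp]:
  "j \<le> \<Delta> \<Longrightarrow> X \<subseteq> {..\<Delta>} \<Longrightarrow> vtx i j \<in> vtx i' ` X \<longleftrightarrow> i = i' \<and> j \<in> X"
  by fastforce

lemma neighbourhood_eqI:
  assumes "i < m" "j \<le> \<Delta>" "A \<subseteq> pverts G"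
    and "\<And>i' j'. i' < m \<Longrightarrow> j' \<le> \<Delta> \<Longrightarrow> adj i j i' j' \<longleftrightarrow> vtx i' j' \<in> A"
  shows "neighbourhood G (vtx i j) = A"
proof -
  have "x \<in> neighbourhood G (vtx i j) \<longleftrightarrow> x \<in> A" if "x \<in> pverts G" for x
  proof -
    obtain i' j' where "x = vtx i' j'" "i' < m" "j' \<le> \<Delta>"
      using \<open>x \<in> pverts G\<close> unfolding verts_eq by blast
    then show ?thesis
      using assms by (simp add: neighbourhood_def arc_iff)
  qed
  moreover have "neighbourhood G (vtx i j) \<subseteq> pverts G"
    using in_arcsD2 by (auto simp: neighbourhood_def)
  ultimately show ?thesis
    using assms(3) by blast
qed

lemma neighbourhood_middle:
  assumes "i < m" "0 < j" "j < \<Delta>"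
  shows "neighbourhood G (vtx i j) = vtx i ` ({..\<Delta>} - {j})"
proof (rule neighbourhood_eqI)
  fix i' j' assume "i' < m" "j' \<le> \<Delta>"
  then show "adj i j i' j' \<longleftrightarrow> vtx i' j' \<in> vtx i ` ({..\<Delta>} - {j})"
    using assms by (subst vtx_in_image_iff) (auto simp: adj_def)
qed (use assms in auto)

lemma neighbourhood_first:
  assumes "i < m"
  shows "neighbourhood G (vtx i 0) = insert (vtx (prv i) \<Delta>) (vtx i ` {0<..<\<Delta>})"
proof (rule neighbourhood_eqI)
  fix i' j' assume *: "i' < m" "j' \<le> \<Delta>"
  have "i = nxt i' \<longleftrightarrow> i' = prv i"
    using * assms by auto
  then show "adj i 0 i' j' \<longleftrightarrow> vtx i' j' \<in> insert (vtx (prv i) \<Delta>) (vtx i ` {0<..<\<Delta>})"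
    using * \<Delta> by (subst insert_iff, subst vtx_in_image_iff) (auto simp: adj_def)
qed (use assms in auto)

lemma neighbourhood_last:
  assumes "i < m"
  shows "neighbourhood G (vtx i \<Delta>) = insert (vtx (nxt i) 0) (vtx i ` {0<..<\<Delta>})"
proof (rule neighbourhood_eqI)
  fix i' j' assume *: "i' < m" "j' \<le> \<Delta>"
  then show "adj i \<Delta> i' j' \<longleftrightarrow> vtx i' j' \<in> insert (vtx (nxt i) 0) (vtx i ` {0<..<\<Delta>})"
    using \<Delta> by (subst insert_iff, subst vtx_in_image_iff) (auto simp: adj_def)
qed (use assms in auto)

text \<open>A middle vertex sees the \<Delta> other vertices of its block; an end sees the
  \<open>\<Delta> - 1\<close> middle ones and one vertex of a neighbouring block.\<close>

lemma regular_G: "regular_graph \<Delta> G"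
proof -
  have inj: "inj_on (vtx i) {..\<Delta>}" for i
    by (rule inj_onI) simp
  have "card (neighbourhood G v) = \<Delta>" if v: "v \<in> pverts G" for v
  proof -
    obtain i j where ij: "v = vtx i j" "i < m" "j \<le> \<Delta>"
      using v by (auto simp: verts_eq)
    have mid: "card (vtx i ` {0<..<\<Delta>}) = \<Delta> - 1"
      using inj_on_subset[OF inj[of i], of "{0<..<\<Delta>}"] by (simp add: card_image subset_eq)
    consider "j = 0" | "j = \<Delta>" | "0 < j" "j < \<Delta>"
      using ij(3) by linarith
    then show ?thesis
    proof cases
      case 1
      have "vtx (prv i) \<Delta> \<notin> vtx i ` {0<..<\<Delta>}"
        by auto
      then show ?thesis
        using ij(2) 1 mid \<Delta> by (simp add: ij(1) neighbourhood_first)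
    next
      case 2
      have "vtx (nxt i) 0 \<notin> vtx i ` {0<..<\<Delta>}"
        by auto
      then show ?thesis
        using ij(2) 2 mid \<Delta> by (simp add: ij(1) neighbourhood_last)
    next
      case 3
      then show ?thesis
        using ij inj_on_subset[OF inj[of i], of "{..\<Delta>} - {j}"]
        by (simp add: neighbourhood_middle card_image subset_eq)
    qed
  qed
  moreover have "out_arcs (with_proj G) v = Pair v ` neighbourhood G v" for v
    by (auto simp: out_arcs_def neighbourhood_def)
  ultimately show ?thesis
    using pair_graph_G by (simp add: regular_graph_def out_degree_def card_image inj_on_def)
qed

subsection \<open>Connectivity of the non-frozen colourings\<close>

abbreviation "Col \<equiv> colourings G (Suc \<Delta>)"
abbreviation "R \<equiv> recolours G (Suc \<Delta>)"

definition loose :: "(nat \<Rightarrow> nat) \<Rightarrow> nat \<Rightarrow> bool" where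
  "loose \<alpha> i \<longleftrightarrow> \<alpha> (vtx i 0) = \<alpha> (vtx i \<Delta>)"

abbreviation block :: "nat \<Rightarrow> nat set" where
  "block i \<equiv> vtx i ` {..\<Delta>}"

lemma colour_range: "\<alpha> \<in> Col \<Longrightarrow> i < m \<Longrightarrow> j \<le> \<Delta> \<Longrightarrow> \<alpha> (vtx i j) \<in> {1..Suc \<Delta>}"
  using colourings_range by simp

lemma colours_adj:
  "\<alpha> \<in> Col \<Longrightarrow> i < m \<Longrightarrow> j \<le> \<Delta> \<Longrightarrow> i' < m \<Longrightarrow> j' \<le> \<Delta> \<Longrightarrow> adj i j i' j' \<Longrightarrow>
    \<alpha> (vtx i j) \<noteq> \<alpha> (vtx i' j')"
  using colourings_proper arc_iff by blast

lemma colours_middle: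
  assumes "\<alpha> \<in> Col" "i < m" "0 < j" "j < \<Delta>" "j' \<le> \<Delta>" "j \<noteq> j'"
  shows "\<alpha> (vtx i j) \<noteq> \<alpha> (vtx i j')"
  using assms by (intro colours_adj) (auto simp: adj_def)

lemma colouring_eqI:
  assumes "\<alpha> \<in> Col" "\<beta> \<in> Col" "\<And>v. v \<in> pverts G \<Longrightarrow> \<alpha> v = \<beta> v"
  shows "\<alpha> = \<beta>"
proof (rule PiE_ext)
  show "\<alpha> \<in> pverts G \<rightarrow>\<^sub>E {1..Suc \<Delta>}" "\<beta> \<in> pverts G \<rightarrow>\<^sub>E {1..Suc \<Delta>}"
    using assms(1,2) unfolding colourings_def by blast+
qed (rule assms(3))

lemma fresh_colour:
  assumes "finite X" "card X \<le> \<Delta>"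
  shows "\<exists>c\<in>{1..Suc \<Delta>}. c \<notin> X"
proof (rule ccontr)
  assume "\<not> ?thesis"
  then have "{1..Suc \<Delta>} \<subseteq> X"
    by blast
  then have "card {1..Suc \<Delta>} \<le> card X"
    using assms(1) by (rule card_mono[rotated])
  then show False
    using assms(2) by simp
qed

text \<open>As \<Delta> \<ge> 3, there are at least four colours. The evasive moves in
  \<open>loosen_next\<close> and \<open>clear_colour\<close> rest on this.\<close>

lemma fresh_colour3: "\<exists>d\<in>{1..Suc \<Delta>}. d \<noteq> a \<and> d \<noteq> b \<and> d \<noteq> c"
proof -
  have "card {a, b, c} \<le> \<Delta>"
    using \<Delta> card_insert_le_m1[of 3 "{b, c}" a] card_insert_le_m1[of 2 "{c}" b] by simp
  then show ?thesis
    using fresh_colour[of "{a, b, c}"] by auto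
qed

text \<open>Only the two ends of a block are non-adjacent. If they differ too, the \<Delta> + 1
  vertices have distinct colours and exhaust the palette.\<close>

lemma tight_block_surj:
  assumes "\<alpha> \<in> Col" "i < m" "\<not> loose \<alpha> i" "c \<in> {1..Suc \<Delta>}"
  shows "c \<in> \<alpha> ` block i"
proof -
  have neq: "\<alpha> (vtx i j) \<noteq> \<alpha> (vtx i j')" if "j \<le> \<Delta>" "j' \<le> \<Delta>" "j < j'" for j j'
  proof (cases "j = 0 \<and> j' = \<Delta>")
    case True
    then show ?thesis
      using assms(3) by (simp add: loose_def)
  next
    case False
    then show ?thesis
      using that assms(1,2) by (intro colours_adj) (auto simp: adj_def)
  qed
  have "inj_on (\<lambda>j. \<alpha> (vtx i j)) {..\<Delta>}"
    by (rule linorder_inj_onI) (use neq in auto)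
  then have "card ((\<lambda>j. \<alpha> (vtx i j)) ` {..\<Delta>}) = card {1..Suc \<Delta>}"
    by (simp add: card_image)
  moreover have "(\<lambda>j. \<alpha> (vtx i j)) ` {..\<Delta>} \<subseteq> {1..Suc \<Delta>}"
    using colour_range[OF assms(1,2)] by auto
  ultimately have "(\<lambda>j. \<alpha> (vtx i j)) ` {..\<Delta>} = {1..Suc \<Delta>}"
    by (intro card_subset_eq) auto
  then show ?thesis
    using assms(4) by (simp add: image_image)
qed

lemma loose_block_missing:
  assumes "loose \<alpha> i"
  shows "\<exists>c\<in>{1..Suc \<Delta>}. c \<notin> \<alpha> ` block i"
proof -
  have "block i = insert (vtx i \<Delta>) (vtx i ` {..<\<Delta>})"
    by (simp flip: lessThan_Suc_atMost add: lessThan_Suc)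
  moreover have "\<alpha> (vtx i \<Delta>) \<in> \<alpha> ` vtx i ` {..<\<Delta>}"
    using assms \<Delta> by (auto simp: loose_def intro!: image_eqI[of _ _ 0] simp: image_image)
  ultimately have "\<alpha> ` block i = (\<lambda>j. \<alpha> (vtx i j)) ` {..<\<Delta>}"
    by (simp add: image_image insert_absorb)
  then have "card (\<alpha> ` block i) \<le> \<Delta>"
    by (metis card_image_le card_lessThan finite_lessThan)
  then show ?thesis
    by (intro fresh_colour) auto
qed

lemma recolour_middle:
  assumes "\<alpha> \<in> Col" "i < m" "0 < j" "j < \<Delta>" "c \<in> {1..Suc \<Delta>}" "c \<notin> \<alpha> ` block i"
  shows "R \<alpha> (\<alpha>(vtx i j := c))"
  unfolding recolours_def using assms
  by (intro conjI bexI[of _ "vtx i j"] bexI[of _ c]) (auto simp: neighbourhood_middle)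

lemma recolour_first:
  assumes "\<alpha> \<in> Col" "i < m" "c \<in> {1..Suc \<Delta>}"
    "c \<notin> \<alpha> ` vtx i ` {0<..<\<Delta>}" "c \<noteq> \<alpha> (vtx (prv i) \<Delta>)"
  shows "R \<alpha> (\<alpha>(vtx i 0 := c))"
  unfolding recolours_def using assms
  by (intro conjI bexI[of _ "vtx i 0"] bexI[of _ c]) (auto simp: neighbourhood_first)

lemma recolour_last:
  assumes "\<alpha> \<in> Col" "i < m" "c \<in> {1..Suc \<Delta>}"
    "c \<notin> \<alpha> ` vtx i ` {0<..<\<Delta>}" "c \<noteq> \<alpha> (vtx (nxt i) 0)"
  shows "R \<alpha> (\<alpha>(vtx i \<Delta> := c))"
  unfolding recolours_def using assms
  by (intro conjI bexI[of _ "vtx i \<Delta>"] bexI[of _ c]) (auto simp: neighbourhood_last)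

text \<open>A colour different from that of the ends occurs on at most one vertex of the block, a
  middle one, which can move to the colour missing from the loose block. That only a vertex coloured
  \<open>c\<close> changes is what makes the count in \<open>permute_middles\<close>
  decrease.\<close>

lemma make_missing:
  assumes \<alpha>: "\<alpha> \<in> Col" and i: "i < m" and "loose \<alpha> i" and c: "c \<noteq> \<alpha> (vtx i 0)"
  obtains \<beta> where "R\<^sup>*\<^sup>* \<alpha> \<beta>" "\<beta> \<in> Col" "c \<notin> \<beta> ` block i"
    "\<forall>v. \<beta> v \<noteq> \<alpha> v \<longrightarrow> v \<in> vtx i ` {0<..<\<Delta>} \<and> \<alpha> v = c"
proof (cases "c \<in> \<alpha> ` block i")
  case False
  then show thesis
    using that[of \<alpha>] \<alpha> by simp
next
  case True
  then obtain j where j: "j \<le> \<Delta>" "\<alpha> (vtx i j) = c"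
    by auto
  then have j': "0 < j" "j < \<Delta>"
    using c \<open>loose \<alpha> i\<close> unfolding loose_def by (metis gr0I, metis le_neq_implies_less)
  obtain d where d: "d \<in> {1..Suc \<Delta>}" "d \<notin> \<alpha> ` block i"
    using loose_block_missing[OF \<open>loose \<alpha> i\<close>] by blast
  define \<beta> where "\<beta> = \<alpha>(vtx i j := d)"
  have "R \<alpha> \<beta>"
    unfolding \<beta>_def by (rule recolour_middle[OF \<alpha> i j' d])
  moreover have "c \<notin> \<beta> ` block i"
  proof
    assume "c \<in> \<beta> ` block i"
    then obtain l where l: "l \<le> \<Delta>" "\<beta> (vtx i l) = c"
      by auto
    have "c \<noteq> d"
      using True d(2) by auto
    then have "l \<noteq> j" "\<alpha> (vtx i l) = c"
      using l j(1) by (auto simp: \<beta>_def split: if_splits)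
    then show False
      using colours_middle[OF \<alpha> i j' l(1)] j(2) by simp
  qed
  moreover have "v \<in> vtx i ` {0<..<\<Delta>} \<and> \<alpha> v = c" if "\<beta> v \<noteq> \<alpha> v" for v
    using that j j' by (auto simp: \<beta>_def split: if_splits)
  ultimately show thesis
    using that[of \<beta>] recolours_colouring by blast
qed

text \<open>First \<open>c\<close> is driven out of the middle of the block, then the ends take it
  one after the other; this is proper since the ends are not adjacent.\<close>

lemma recolour_loose_block:
  assumes \<alpha>: "\<alpha> \<in> Col" and i: "i < m" and loose: "loose \<alpha> i" and c: "c \<in> {1..Suc \<Delta>}"
    and "c \<noteq> \<alpha> (vtx (prv i) \<Delta>)" "c \<noteq> \<alpha> (vtx (nxt i) 0)"
  obtains \<beta> where "R\<^sup>*\<^sup>* \<alpha> \<beta>" "\<beta> \<in> Col" "\<beta> (vtx i 0) = c" "\<beta> (vtx i \<Delta>) = c"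
    "\<forall>v. v \<notin> block i \<longrightarrow> \<beta> v = \<alpha> v"
proof (cases "c = \<alpha> (vtx i 0)")
  case True
  then show thesis
    using that[of \<alpha>] \<alpha> loose by (simp add: loose_def)
next
  case False
  obtain \<beta> where \<beta>: "R\<^sup>*\<^sup>* \<alpha> \<beta>" "\<beta> \<in> Col" "c \<notin> \<beta> ` block i"
      "\<forall>v. \<beta> v \<noteq> \<alpha> v \<longrightarrow> v \<in> vtx i ` {0<..<\<Delta>} \<and> \<alpha> v = c"
    by (rule make_missing[OF \<alpha> i loose False])
  have outside: "\<beta> v = \<alpha> v" if "v \<notin> block i" for v
    using \<beta>(4)[rule_format, of v] that by (cases "\<beta> v = \<alpha> v") auto
  have "vtx (prv i) \<Delta> \<notin> block i" "vtx (nxt i) 0 \<notin> block i"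
    using i prv_neq[OF i] nxt_neq[of i] by auto
  then have ends: "c \<noteq> \<beta> (vtx (prv i) \<Delta>)" "c \<noteq> \<beta> (vtx (nxt i) 0)"
    using assms(5,6) outside by simp_all
  define \<gamma> where "\<gamma> = \<beta>(vtx i 0 := c)"
  define \<delta> where "\<delta> = \<gamma>(vtx i \<Delta> := c)"
  have "R \<beta> \<gamma>"
    unfolding \<gamma>_def using \<beta>(3) by (intro recolour_first[OF \<beta>(2) i c _ ends(1)]) auto
  then have \<gamma>: "\<gamma> \<in> Col"
    by (rule recolours_colouring)
  have "R \<gamma> \<delta>"
    unfolding \<delta>_def
  proof (rule recolour_last[OF \<gamma> i c])
    show "c \<notin> \<gamma> ` vtx i ` {0<..<\<Delta>}"
      using \<beta>(3) by (auto simp: \<gamma>_def)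
    show "c \<noteq> \<gamma> (vtx (nxt i) 0)"
      using ends(2) nxt_neq[of i] by (auto simp: \<gamma>_def)
  qed
  show thesis
  proof (rule that[of \<delta>])
    show "R\<^sup>*\<^sup>* \<alpha> \<delta>"
      using \<beta>(1) \<open>R \<beta> \<gamma>\<close> \<open>R \<gamma> \<delta>\<close> by simp
    show "\<delta> \<in> Col"
      using \<open>R \<gamma> \<delta>\<close> by (rule recolours_colouring)
    show "\<delta> (vtx i 0) = c" "\<delta> (vtx i \<Delta>) = c"
      by (simp_all add: \<delta>_def \<gamma>_def)
    show "\<forall>v. v \<notin> block i \<longrightarrow> \<delta> v = \<alpha> v"
      using outside by (auto simp: \<delta>_def \<gamma>_def)
  qed
qed

section \<open>Making all blocks loose\<close>

text \<open>If the block of the recolourable vertex is tight, the new colour already occurs in it,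
  on a vertex not adjacent to \<open>v\<close>. The only such pair is the two ends, so recolouring
  makes them equal.\<close>

lemma nonfrozen_reaches_loose:
  assumes "\<alpha> \<in> nonfrozen G (Suc \<Delta>)"
  obtains \<beta> i where "R\<^sup>*\<^sup>* \<alpha> \<beta>" "\<beta> \<in> Col" "i < m" "loose \<beta> i"
proof -
  obtain v c where \<alpha>: "\<alpha> \<in> Col" and "v \<in> pverts G" and c: "c \<in> {1..Suc \<Delta>}"
    "c \<noteq> \<alpha> v" "c \<notin> \<alpha> ` neighbourhood G v"
    using assms unfolding nonfrozen_iff by blast
  then obtain i j where ij: "v = vtx i j" "i < m" "j \<le> \<Delta>"
    by (auto simp: verts_eq)
  show thesis
  proof (cases "loose \<alpha> i")
    case True
    then show thesis
      using that[of \<alpha> i] \<alpha> ij by simp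
  next
    case False
    then obtain l where l: "l \<le> \<Delta>" "\<alpha> (vtx i l) = c"
      using tight_block_surj[OF \<alpha> ij(2) _ c(1)] by auto
    define \<beta> where "\<beta> = \<alpha>(v := c)"
    have "R \<alpha> \<beta>"
      unfolding recolours_def \<beta>_def using \<alpha> ij c vtx_in_verts by blast
    have l_notin: "vtx i l \<notin> neighbourhood G (vtx i j)" "l \<noteq> j"
      using c l ij by auto
    consider "j = 0" | "j = \<Delta>" | "0 < j" "j < \<Delta>"
      using ij(3) by linarith
    then have "j = 0 \<and> l = \<Delta> \<or> j = \<Delta> \<and> l = 0"
      by cases (use l_notin l ij in \<open>auto simp: neighbourhood_first neighbourhood_last neighbourhood_middle\<close>)
    then have "loose \<beta> i"
      using l ij \<Delta> by (auto simp: loose_def \<beta>_def)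
    then show thesis
      using that[of \<beta> i] \<open>R \<alpha> \<beta>\<close> recolours_colouring ij(2) by blast
  qed
qed

text \<open>
  If the colour of a loose block blocks the first vertex of the next block, the loose block first
  moves to a colour avoiding the three colours around it; this uses \<open>\<Delta> + 1 \<ge> 4\<close>.
\<close>

lemma loosen_next:
  assumes \<alpha>: "\<alpha> \<in> Col" and i: "i < m" and "loose \<alpha> i"
  obtains \<beta> where "R\<^sup>*\<^sup>* \<alpha> \<beta>" "\<beta> \<in> Col" "loose \<beta> (nxt i)"
    "\<forall>l<m. loose \<alpha> l \<longrightarrow> loose \<beta> l"
proof -
  define c where "c = \<alpha> (vtx (nxt i) \<Delta>)"
  obtain d where d: "d \<in> {1..Suc \<Delta>}" "d \<noteq> c" "d \<noteq> \<alpha> (vtx (prv i) \<Delta>)" "d \<noteq> \<alpha> (vtx (nxt i) 0)"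
    using fresh_colour3 by blast
  obtain \<beta> where \<beta>: "R\<^sup>*\<^sup>* \<alpha> \<beta>" "\<beta> \<in> Col" "\<beta> (vtx i 0) = d" "\<beta> (vtx i \<Delta>) = d"
      "\<forall>v. v \<notin> block i \<longrightarrow> \<beta> v = \<alpha> v"
    by (rule recolour_loose_block[OF \<alpha> i \<open>loose \<alpha> i\<close> d(1,3,4)])
  have other: "\<beta> (vtx l j) = \<alpha> (vtx l j)" if "l \<noteq> i" "j \<le> \<Delta>" for l j
    using that by (intro \<beta>(5)[rule_format]) auto
  have c: "c = \<beta> (vtx (nxt i) \<Delta>)"
    using other[of "nxt i"] by (simp add: c_def)
  define \<gamma> where "\<gamma> = \<beta>(vtx (nxt i) 0 := c)"
  have "R \<beta> \<gamma>"
    unfolding \<gamma>_def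
  proof (rule recolour_first[OF \<beta>(2)])
    show "nxt i < m" "c \<in> {1..Suc \<Delta>}"
      using i colour_range[OF \<alpha>, of "nxt i" \<Delta>] by (simp_all add: c_def)
    show "c \<noteq> \<beta> (vtx (prv (nxt i)) \<Delta>)"
      using i d(2) \<beta>(4) by simp
    show "c \<notin> \<beta> ` vtx (nxt i) ` {0<..<\<Delta>}"
    proof
      assume "c \<in> \<beta> ` vtx (nxt i) ` {0<..<\<Delta>}"
      then obtain j where "0 < j" "j < \<Delta>" "\<beta> (vtx (nxt i) j) = c"
        by auto
      then show False
        using colours_middle[OF \<beta>(2) nxt_less[OF i], of j \<Delta>] c by simp
    qed
  qed
  moreover have "loose \<gamma> (nxt i)"
    using c \<Delta> by (simp add: loose_def \<gamma>_def)
  moreover have "loose \<gamma> l" if "l < m" "loose \<alpha> l" for l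
  proof -
    consider "l = nxt i" | "l = i" | "l \<noteq> i" "l \<noteq> nxt i"
      by blast
    then show ?thesis
    proof cases
      case 1
      then show ?thesis
        using calculation(2) by simp
    next
      case 2
      then show ?thesis
        using \<beta>(3,4) nxt_neq[of i, symmetric] by (simp add: loose_def \<gamma>_def)
    next
      case 3
      then show ?thesis
        using other[of l] that(2) by (simp add: loose_def \<gamma>_def)
    qed
  qed
  moreover have "R\<^sup>*\<^sup>* \<alpha> \<gamma>"
    using \<beta>(1) \<open>R \<beta> \<gamma>\<close> by simp
  ultimately show thesis
    using that[of \<gamma>] recolours_colouring[OF \<open>R \<beta> \<gamma>\<close>] by simp
qed

text \<open>Induction around the ring: up to block \<open>m - 1\<close>, across to block 0, then up
  to \<open>j\<close>.\<close>

lemma nxt_closed_all: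
  assumes "i < m" "P i" and step: "\<And>i. i < m \<Longrightarrow> P i \<Longrightarrow> P (nxt i)" and "j < m"
  shows "P j"
proof -
  have up: "P (l + d)" if "P l" "l + d < m" for l d
    using that(2)
  proof (induction d)
    case (Suc d)
    then show ?case
      using step[of "l + d"] by (simp add: nxt_def)
  qed (use that(1) in simp)
  have "P (m - 1)"
    using up[of i "m - 1 - i"] assms(1,2) by simp
  then have "P 0"
    using step[of "m - 1"] assms(1) by (simp add: nxt_def)
  then show ?thesis
    using up[of 0 j] assms(4) by simp
qed

text \<open>While loose and tight blocks coexist, some loose block is followed by a tight one;
  \<open>loosen_next\<close> loosens it without losing any loose block.\<close>

lemma reaches_all_loose:
  assumes "\<alpha> \<in> Col" "i < m" "loose \<alpha> i"
  shows "\<exists>\<beta>. R\<^sup>*\<^sup>* \<alpha> \<beta> \<and> \<beta> \<in> Col \<and> (\<forall>l<m. loose \<beta> l)"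
  using assms
proof (induction "card {l. l < m \<and> \<not> loose \<alpha> l}" arbitrary: \<alpha> i rule: less_induct)
  case less
  show ?case
  proof (cases "\<forall>l<m. loose \<alpha> l")
    case True
    then show ?thesis
      using less.prems(1) by blast
  next
    case False
    then obtain l where l: "l < m" "loose \<alpha> l" "\<not> loose \<alpha> (nxt l)"
      using nxt_closed_all[of i "loose \<alpha>"] less.prems by blast
    obtain \<beta> where \<beta>: "R\<^sup>*\<^sup>* \<alpha> \<beta>" "\<beta> \<in> Col" "loose \<beta> (nxt l)"
        "\<forall>l<m. loose \<alpha> l \<longrightarrow> loose \<beta> l"
      by (rule loosen_next[OF less.prems(1) l(1,2)])
    have "card {l. l < m \<and> \<not> loose \<beta> l} < card {l. l < m \<and> \<not> loose \<alpha> l}"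
    proof (rule psubset_card_mono)
      show "{l. l < m \<and> \<not> loose \<beta> l} \<subset> {l. l < m \<and> \<not> loose \<alpha> l}"
        using \<beta>(3,4) l(3) nxt_less[OF l(1)] by blast
    qed simp
    then obtain \<gamma> where \<gamma>: "R\<^sup>*\<^sup>* \<beta> \<gamma>" "\<gamma> \<in> Col" "\<forall>l<m. loose \<gamma> l"
      using less.hyps[OF _ \<beta>(2) nxt_less[OF l(1)] \<beta>(3)] by blast
    have "R\<^sup>*\<^sup>* \<alpha> \<gamma>"
      using \<beta>(1) \<gamma>(1) by (rule rtranclp_trans)
    then show ?thesis
      using \<gamma>(2,3) by blast
  qed
qed

section \<open>Moves between colourings with all blocks loose\<close>

abbreviation "LooseCol \<equiv> {\<alpha> \<in> Col. \<forall>l<m. loose \<alpha> l}"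

text \<open>With all blocks loose, a block acts as a single vertex of a cycle of length
  \<open>m\<close>, its colour being that of its ends.\<close>

lemma recolour_all_loose:
  assumes \<alpha>: "\<alpha> \<in> LooseCol" and i: "i < m" and c: "c \<in> {1..Suc \<Delta>}"
    and "c \<noteq> \<alpha> (vtx (prv i) 0)" "c \<noteq> \<alpha> (vtx (nxt i) 0)"
  obtains \<beta> where "R\<^sup>*\<^sup>* \<alpha> \<beta>" "\<beta> \<in> LooseCol" "\<beta> (vtx i 0) = c"
    "\<forall>l<m. l \<noteq> i \<longrightarrow> \<beta> (vtx l 0) = \<alpha> (vtx l 0)"
proof -
  have \<alpha>': "\<alpha> \<in> Col" "loose \<alpha> i" "c \<noteq> \<alpha> (vtx (prv i) \<Delta>)"
    using \<alpha> i prv_less[OF i] assms(4) by (auto simp: loose_def)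
  obtain \<beta> where \<beta>: "R\<^sup>*\<^sup>* \<alpha> \<beta>" "\<beta> \<in> Col" "\<beta> (vtx i 0) = c" "\<beta> (vtx i \<Delta>) = c"
      "\<forall>v. v \<notin> block i \<longrightarrow> \<beta> v = \<alpha> v"
    by (rule recolour_loose_block[OF \<alpha>'(1) i \<alpha>'(2) c \<alpha>'(3) assms(5)])
  have other: "\<beta> (vtx l j) = \<alpha> (vtx l j)" if "l \<noteq> i" "j \<le> \<Delta>" for l j
    using that by (intro \<beta>(5)[rule_format]) auto
  have "loose \<beta> l" if "l < m" for l
    using \<alpha> that \<beta>(3,4) other[of l] by (cases "l = i") (auto simp: loose_def)
  then show thesis
    using that[of \<beta>] \<beta> other by simp
qed

lemma clear_colour:
  assumes \<alpha>: "\<alpha> \<in> LooseCol" and i: "i < m"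
  obtains \<beta> where "R\<^sup>*\<^sup>* \<alpha> \<beta>" "\<beta> \<in> LooseCol" "\<beta> (vtx i 0) \<noteq> c"
    "\<forall>l<m. \<beta> (vtx l 0) \<noteq> \<alpha> (vtx l 0) \<longrightarrow> l = i \<and> \<alpha> (vtx l 0) = c"
proof (cases "\<alpha> (vtx i 0) = c")
  case False
  then show thesis
    using that[of \<alpha>] \<alpha> by simp
next
  case True
  obtain d where d: "d \<in> {1..Suc \<Delta>}" "d \<noteq> c" "d \<noteq> \<alpha> (vtx (prv i) 0)" "d \<noteq> \<alpha> (vtx (nxt i) 0)"
    using fresh_colour3 by blast
  obtain \<beta> where "R\<^sup>*\<^sup>* \<alpha> \<beta>" "\<beta> \<in> LooseCol" "\<beta> (vtx i 0) = d"
      "\<forall>l<m. l \<noteq> i \<longrightarrow> \<beta> (vtx l 0) = \<alpha> (vtx l 0)"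
    by (rule recolour_all_loose[OF \<alpha> i d(1,3,4)])
  then show thesis
    using that[of \<beta>] True d(2) by metis
qed

text \<open>The alternating colouring of the ring with colours 1 and 2, the common destination of
  all paths.\<close>

definition target :: "nat \<Rightarrow> nat" where
  "target i = Suc (i mod 2)"

lemma target_nxt: "i < m \<Longrightarrow> target (nxt i) \<noteq> target i"
proof -
  assume "i < m"
  show ?thesis
  proof (cases "Suc i = m")
    case True
    \<comment> \<open>At the wrap-around, alternation survives because \<open>m = 2 * k\<close> is
      even.\<close>
    then have "odd i"
      by presburger
    then show ?thesis
      using True by (simp add: target_def nxt_def odd_iff_mod_2_eq_one)
  next
    case False
    then show ?thesis
      by (simp add: target_def nxt_def mod_Suc)
  qed
qed

lemma target_prv: "i < m \<Longrightarrow> target (prv i) \<noteq> target i"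
  using target_nxt[of "prv i"] by simp

text \<open>Both neighbours of a wrong block \<open>i\<close> are cleared of the colour
  \<open>target i\<close>, then \<open>i\<close> takes it. A neighbour that had to move was itself
  wrong, since its target differs from \<open>target i\<close>, so the number of wrong blocks
  drops.\<close>

lemma reaches_target:
  assumes "\<alpha> \<in> LooseCol"
  shows "\<exists>\<beta>. R\<^sup>*\<^sup>* \<alpha> \<beta> \<and> \<beta> \<in> LooseCol \<and> (\<forall>l<m. \<beta> (vtx l 0) = target l)"
  using assms
proof (induction "card {l. l < m \<and> \<alpha> (vtx l 0) \<noteq> target l}" arbitrary: \<alpha> rule: less_induct)
  case less
  show ?case
  proof (cases "\<forall>l<m. \<alpha> (vtx l 0) = target l")
    case True
    then show ?thesis
      using less.prems by blast
  next
    case False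
    then obtain i where i: "i < m" "\<alpha> (vtx i 0) \<noteq> target i"
      by blast
    obtain \<beta> where \<beta>: "R\<^sup>*\<^sup>* \<alpha> \<beta>" "\<beta> \<in> LooseCol" "\<beta> (vtx (prv i) 0) \<noteq> target i"
        "\<forall>l<m. \<beta> (vtx l 0) \<noteq> \<alpha> (vtx l 0) \<longrightarrow> l = prv i \<and> \<alpha> (vtx l 0) = target i"
      by (rule clear_colour[OF less.prems prv_less[OF i(1)], of "target i"])
    obtain \<gamma> where \<gamma>: "R\<^sup>*\<^sup>* \<beta> \<gamma>" "\<gamma> \<in> LooseCol" "\<gamma> (vtx (nxt i) 0) \<noteq> target i"
        "\<forall>l<m. \<gamma> (vtx l 0) \<noteq> \<beta> (vtx l 0) \<longrightarrow> l = nxt i \<and> \<beta> (vtx l 0) = target i"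
      by (rule clear_colour[OF \<beta>(2) nxt_less[OF i(1)], of "target i"])
    \<comment> \<open>The second clearing moves only blocks of colour \<open>target i\<close>, so
      the previous block, already cleared, stays put.\<close>
    have \<gamma>_prv: "\<gamma> (vtx (prv i) 0) \<noteq> target i"
      using \<beta>(3) \<gamma>(4)[rule_format, of "prv i"] i(1) by fastforce
    have t: "target i \<in> {1..Suc \<Delta>}"
      using \<Delta> by (simp add: target_def)
    obtain \<delta> where \<delta>: "R\<^sup>*\<^sup>* \<gamma> \<delta>" "\<delta> \<in> LooseCol" "\<delta> (vtx i 0) = target i"
        "\<forall>l<m. l \<noteq> i \<longrightarrow> \<delta> (vtx l 0) = \<gamma> (vtx l 0)"
      by (rule recolour_all_loose[OF \<gamma>(2) i(1) t \<gamma>_prv[symmetric] \<gamma>(3)[symmetric]])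
    have keep: "\<delta> (vtx l 0) = target l" if "l < m" "\<alpha> (vtx l 0) = target l" for l
    proof -
      have "l \<noteq> i"
        using that i(2) by auto
      have "\<beta> (vtx l 0) = target l"
        using \<beta>(4)[rule_format, of l] that target_prv[OF i(1)] by metis
      then have "\<gamma> (vtx l 0) = target l"
        using \<gamma>(4)[rule_format, of l] that target_nxt[OF i(1)] by metis
      then show ?thesis
        using \<delta>(4)[rule_format, of l] \<open>l \<noteq> i\<close> that(1) by simp
    qed
    have "card {l. l < m \<and> \<delta> (vtx l 0) \<noteq> target l} < card {l. l < m \<and> \<alpha> (vtx l 0) \<noteq> target l}"
    proof (rule psubset_card_mono)
      show "{l. l < m \<and> \<delta> (vtx l 0) \<noteq> target l} \<subset> {l. l < m \<and> \<alpha> (vtx l 0) \<noteq> target l}"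
        using keep i \<delta>(3) by blast
    qed simp
    then obtain \<epsilon> where \<epsilon>: "R\<^sup>*\<^sup>* \<delta> \<epsilon>" "\<epsilon> \<in> LooseCol" "\<forall>l<m. \<epsilon> (vtx l 0) = target l"
      using less.hyps[OF _ \<delta>(2)] by blast
    have "R\<^sup>*\<^sup>* \<alpha> \<epsilon>"
      using \<beta>(1) \<gamma>(1) \<delta>(1) \<epsilon>(1) by (meson rtranclp_trans)
    then show ?thesis
      using \<epsilon>(2,3) by blast
  qed
qed

text \<open>Only middle vertices can disagree. To give one of them its colour \<open>c\<close> under
  \<beta>, \<open>c\<close> is first freed within the block. A vertex that gives up \<open>c\<close>
  was wrong already, since \<beta> has \<open>c\<close> elsewhere in the block, so the number of
  disagreements drops.\<close>

lemma permute_middles: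
  assumes "\<alpha> \<in> LooseCol" "\<beta> \<in> LooseCol" "\<And>l. l < m \<Longrightarrow> \<alpha> (vtx l 0) = \<beta> (vtx l 0)"
  shows "R\<^sup>*\<^sup>* \<alpha> \<beta>"
  using assms
proof (induction "card {v \<in> pverts G. \<alpha> v \<noteq> \<beta> v}" arbitrary: \<alpha> rule: less_induct)
  case less
  have \<alpha>: "\<alpha> \<in> Col" and \<beta>: "\<beta> \<in> Col"
    using less.prems by auto
  show ?case
  proof (cases "\<forall>v\<in>pverts G. \<alpha> v = \<beta> v")
    case True
    then have "\<alpha> = \<beta>"
      using \<alpha> \<beta> by (intro colouring_eqI) auto
    then show ?thesis
      by simp
  next
    case False
    then obtain i j where ij: "i < m" "j \<le> \<Delta>" "\<alpha> (vtx i j) \<noteq> \<beta> (vtx i j)"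
      by (auto simp: verts_eq)
    have ends: "\<alpha> (vtx l 0) = \<beta> (vtx l 0)" "\<alpha> (vtx l \<Delta>) = \<beta> (vtx l \<Delta>)" "loose \<alpha> l"
      if "l < m" for l
      using less.prems that by (auto simp: loose_def)
    have j: "0 < j" "j < \<Delta>"
      using ij ends[OF ij(1)] by (metis gr0I, metis le_neq_implies_less)
    define c where "c = \<beta> (vtx i j)"
    have c_neq: "c \<noteq> \<alpha> (vtx i 0)"
      using colours_middle[OF \<beta> ij(1) j, of 0] ends[OF ij(1)] j by (simp add: c_def)
    obtain \<gamma> where \<gamma>: "R\<^sup>*\<^sup>* \<alpha> \<gamma>" "\<gamma> \<in> Col" "c \<notin> \<gamma> ` block i"
        "\<forall>v. \<gamma> v \<noteq> \<alpha> v \<longrightarrow> v \<in> vtx i ` {0<..<\<Delta>} \<and> \<alpha> v = c"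
      by (rule make_missing[OF \<alpha> ij(1) ends(3)[OF ij(1)] c_neq])
    define \<delta> where "\<delta> = \<gamma>(vtx i j := c)"
    have "c \<in> {1..Suc \<Delta>}"
      using colour_range[OF \<beta> ij(1,2)] by (simp add: c_def)
    then have "R \<gamma> \<delta>"
      unfolding \<delta>_def using \<gamma>(2,3) ij(1) j by (intro recolour_middle)
    have same: "\<delta> (vtx l j') = \<alpha> (vtx l j')" if "l < m" "j' = 0 \<or> j' = \<Delta>" for l j'
      using \<gamma>(4)[rule_format, of "vtx l j'"] that j by (fastforce simp: \<delta>_def)
    have "\<delta> \<in> LooseCol"
      using recolours_colouring[OF \<open>R \<gamma> \<delta>\<close>] same ends(3) by (simp add: loose_def)
    moreover have "\<delta> (vtx l 0) = \<beta> (vtx l 0)" if "l < m" for l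
      using same[OF that] ends(1)[OF that] by simp
    moreover have "card {v \<in> pverts G. \<delta> v \<noteq> \<beta> v} < card {v \<in> pverts G. \<alpha> v \<noteq> \<beta> v}"
    proof (rule psubset_card_mono)
      have "\<alpha> v \<noteq> \<beta> v" if "v \<in> pverts G" "\<delta> v \<noteq> \<beta> v" for v
      proof (cases "\<gamma> v = \<alpha> v")
        case True
        then show ?thesis
          using that by (auto simp: \<delta>_def c_def split: if_splits)
      next
        case False
        then obtain j' where j': "v = vtx i j'" "0 < j'" "j' < \<Delta>" "\<alpha> v = c"
          using \<gamma>(4) by auto
        then have "j' \<noteq> j"
          using ij by (auto simp: c_def)
        then show ?thesis
          using colours_middle[OF \<beta> ij(1) j, of j'] j' by (simp add: c_def)
      qed
      moreover have "\<delta> (vtx i j) = \<beta> (vtx i j)"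
        by (simp add: \<delta>_def c_def)
      ultimately show "{v \<in> pverts G. \<delta> v \<noteq> \<beta> v} \<subset> {v \<in> pverts G. \<alpha> v \<noteq> \<beta> v}"
        using ij vtx_in_verts by blast
    qed (simp add: finite_verts)
    ultimately have "R\<^sup>*\<^sup>* \<delta> \<beta>"
      using less.hyps less.prems(2) by blast
    then show ?thesis
      using \<gamma>(1) \<open>R \<gamma> \<delta>\<close> by (meson converse_rtranclp_into_rtranclp rtranclp_trans)
  qed
qed

text \<open>Both colourings reach the same end colours; the middles are then matched, and the path
  from \<beta> is run backwards.\<close>

lemma nonfrozen_connected:
  assumes "\<alpha> \<in> nonfrozen G (Suc \<Delta>)" "\<beta> \<in> nonfrozen G (Suc \<Delta>)"
  shows "R\<^sup>*\<^sup>* \<alpha> \<beta>"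
proof -
  have reach: "\<exists>\<gamma>. R\<^sup>*\<^sup>* \<alpha> \<gamma> \<and> \<gamma> \<in> LooseCol \<and> (\<forall>l<m. \<gamma> (vtx l 0) = target l)"
    if "\<alpha> \<in> nonfrozen G (Suc \<Delta>)" for \<alpha>
  proof -
    obtain \<alpha>' i where 1: "R\<^sup>*\<^sup>* \<alpha> \<alpha>'" "\<alpha>' \<in> Col" "i < m" "loose \<alpha>' i"
      by (rule nonfrozen_reaches_loose[OF \<open>\<alpha> \<in> nonfrozen G (Suc \<Delta>)\<close>])
    obtain \<alpha>'' where 2: "R\<^sup>*\<^sup>* \<alpha>' \<alpha>''" "\<alpha>'' \<in> LooseCol"
      using reaches_all_loose[OF 1(2-4)] by blast
    show ?thesis
      using reaches_target[OF 2(2)] rtranclp_trans[OF 1(1) 2(1)] rtranclp_trans[of R \<alpha> \<alpha>''] by blast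
  qed
  obtain \<gamma> where \<gamma>: "R\<^sup>*\<^sup>* \<alpha> \<gamma>" "\<gamma> \<in> LooseCol" "\<forall>l<m. \<gamma> (vtx l 0) = target l"
    using reach[OF assms(1)] by blast
  obtain \<delta> where \<delta>: "R\<^sup>*\<^sup>* \<beta> \<delta>" "\<delta> \<in> LooseCol" "\<forall>l<m. \<delta> (vtx l 0) = target l"
    using reach[OF assms(2)] by blast
  have "R\<^sup>*\<^sup>* \<gamma> \<delta>"
    using \<gamma>(2,3) \<delta>(2,3) by (intro permute_middles) auto
  then show ?thesis
    using \<gamma>(1) rtranclp_recolours_sym[OF \<delta>(1)] by (meson rtranclp_trans)
qed

subsection \<open>Spread of damage\<close>

lemma card_verts: "card (pverts G) = m * Suc \<Delta>"
  by (simp add: G_def)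

text \<open>Middle colours are left free: in a proper colouring the ends 1 and 2 already force the
  middle to use exactly the other colours.\<close>

definition good :: "(nat \<Rightarrow> nat) \<Rightarrow> nat \<Rightarrow> bool" where
  "good \<alpha> i \<longleftrightarrow> \<alpha> (vtx i 0) = 1 \<and> \<alpha> (vtx i \<Delta>) = 2"

text \<open>The run of blocks from \<open>i + 1\<close> to \<open>m - j - 1\<close>. Counting the
  right border from the end makes \<open>i + j\<close> the number of blocks lost from the full run,
  and addition avoids truncated subtraction.\<close>

definition good_between :: "(nat \<Rightarrow> nat) \<Rightarrow> nat \<Rightarrow> nat \<Rightarrow> bool" where
  "good_between \<alpha> i j \<longleftrightarrow> (\<forall>l. i < l \<and> l + j < m \<longrightarrow> good \<alpha> l)"

text \<open>
  The complement of a longest run of good blocks within \<open>1, \<dots>, m - 1\<close>, measured so that a run of all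
  of them has damage 0 (block 0 is damaged from the start and is ignored).
\<close>

definition damage :: "(nat \<Rightarrow> nat) \<Rightarrow> nat" where
  "damage \<alpha> = (LEAST d. \<exists>i j. i + j = d \<and> good_between \<alpha> i j)"

lemma damage_witness: obtains i j where "damage \<alpha> = i + j" "good_between \<alpha> i j"
proof -
  \<comment> \<open>The empty run ensures that the \<open>LEAST\<close> in \<open>damage\<close>
    ranges over a nonempty set.\<close>
  have "\<exists>i j. i + j = m \<and> good_between \<alpha> i j"
    by (intro exI[of _ m] exI[of _ 0]) (simp add: good_between_def)
  then have "\<exists>i j. i + j = damage \<alpha> \<and> good_between \<alpha> i j"
    unfolding damage_def by (rule LeastI)
  then show thesis
    using that by metis
qed

lemma damage_le: "good_between \<alpha> i j \<Longrightarrow> damage \<alpha> \<le> i + j"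
  unfolding damage_def by (rule Least_le) blast

text \<open>From \<open>i + j < k\<close> follow \<open>i < k\<close> and
  \<open>k + j < 2 * k\<close>, so block \<open>k\<close>, opposite to block 0, lies in the
  run.\<close>

lemma small_damage_good:
  assumes "damage \<alpha> < k"
  shows "good \<alpha> k"
proof -
  obtain i j where "damage \<alpha> = i + j" "good_between \<alpha> i j"
    by (rule damage_witness)
  then show ?thesis
    using assms by (simp add: good_between_def)
qed

text \<open>A good block is tight, so any other colour \<open>c\<close> occurs in it. On a middle
  vertex it is seen directly; if it is the 2 at the far end, the end of the previous good block
  shows 2 as well.\<close>

lemma good_first_stuck:
  assumes \<alpha>: "\<alpha> \<in> Col" and l: "l < m" "good \<alpha> l" "good \<alpha> (prv l)" and c: "c \<in> {1..Suc \<Delta>}"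
  shows "recolour_choice G \<alpha> (vtx l 0, c) = \<alpha>"
proof (cases "c = \<alpha> (vtx l 0)")
  case False
  have "\<not> loose \<alpha> l"
    using l(2) by (simp add: loose_def good_def)
  then obtain j where j: "j \<le> \<Delta>" "\<alpha> (vtx l j) = c"
    using tight_block_surj[OF \<alpha> l(1) _ c] by auto
  have "c \<in> \<alpha> ` neighbourhood G (vtx l 0)"
  proof (cases "j = \<Delta>")
    case True
    then have "c = \<alpha> (vtx (prv l) \<Delta>)"
      using j l(2,3) by (simp add: good_def)
    then show ?thesis
      by (simp add: neighbourhood_first[OF l(1)])
  next
    case jneq: False
    have "j \<noteq> 0"
      using j(2) False by metis
    then have "vtx l j \<in> vtx l ` {0<..<\<Delta>}"
      using j(1) jneq by auto
    then show ?thesis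
      using j(2) by (auto simp: neighbourhood_first[OF l(1)] simp del: vtx_in_image_iff)
  qed
  then show ?thesis
    by (simp add: recolour_choice_def)
qed (simp add: recolour_choice_def)

lemma good_last_stuck:
  assumes \<alpha>: "\<alpha> \<in> Col" and l: "l < m" "good \<alpha> l" "good \<alpha> (nxt l)" and c: "c \<in> {1..Suc \<Delta>}"
  shows "recolour_choice G \<alpha> (vtx l \<Delta>, c) = \<alpha>"
proof (cases "c = \<alpha> (vtx l \<Delta>)")
  case False
  have "\<not> loose \<alpha> l"
    using l(2) by (simp add: loose_def good_def)
  then obtain j where j: "j \<le> \<Delta>" "\<alpha> (vtx l j) = c"
    using tight_block_surj[OF \<alpha> l(1) _ c] by auto
  have "c \<in> \<alpha> ` neighbourhood G (vtx l \<Delta>)"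
  proof (cases "j = 0")
    case True
    then have "c = \<alpha> (vtx (nxt l) 0)"
      using j l(2,3) by (simp add: good_def)
    then show ?thesis
      by (simp add: neighbourhood_last[OF l(1)])
  next
    case jneq: False
    have "j \<noteq> \<Delta>"
      using j(2) False by metis
    then have "vtx l j \<in> vtx l ` {0<..<\<Delta>}"
      using j(1) jneq by auto
    then show ?thesis
      using j(2) by (auto simp: neighbourhood_last[OF l(1)] simp del: vtx_in_image_iff)
  qed
  then show ?thesis
    by (simp add: recolour_choice_def)
qed (simp add: recolour_choice_def)

text \<open>The two excluded vertices are the outer ends of the run, which face blocks not known to
  be good. All other ends in the run are stuck, and middle vertices do not affect
  \<open>good\<close>.\<close>

lemma good_between_step:
  assumes \<alpha>: "\<alpha> \<in> Col" and gap: "good_between \<alpha> i j" and c: "c \<in> {1..Suc \<Delta>}"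
    and v: "v \<noteq> vtx (Suc i) 0" "v \<noteq> vtx (m - Suc j) \<Delta>"
  shows "good_between (recolour_choice G \<alpha> (v, c)) i j"
  unfolding good_between_def
proof (intro allI impI, elim conjE)
  fix l assume l: "i < l" "l + j < m"
  have good: "good \<alpha> l'" if "i < l'" "l' + j < m" for l'
    using gap that by (simp add: good_between_def)
  consider "v = vtx l 0" | "v = vtx l \<Delta>" | "v \<noteq> vtx l 0" "v \<noteq> vtx l \<Delta>"
    by blast
  then show "good (recolour_choice G \<alpha> (v, c)) l"
  proof cases
    case 1
    then have "l \<noteq> Suc i"
      using v(1) by auto
    then have "good \<alpha> (prv l)"
      using l by (intro good) (auto simp: prv_def)
    then show ?thesis
      using good_first_stuck[OF \<alpha> _ good[OF l] _ c] l 1 good[OF l] by simp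
  next
    case 2
    then have "Suc l + j \<noteq> m"
      using v(2) by auto
    then have "good \<alpha> (nxt l)"
      using l by (intro good) (auto simp: nxt_def)
    then show ?thesis
      using good_last_stuck[OF \<alpha> _ good[OF l] _ c] l 2 good[OF l] by simp
  next
    case 3
    then show ?thesis
      using good[OF l] by (simp add: good_def recolour_choice_def)
  qed
qed

text \<open>If an outer end of the run moves, giving up its block leaves a shorter run whose outer
  ends are not touched by this move.\<close>

lemma good_between_grow:
  assumes \<alpha>: "\<alpha> \<in> Col" and gap: "good_between \<alpha> i j" and c: "c \<in> {1..Suc \<Delta>}"
  shows "damage (recolour_choice G \<alpha> (v, c)) \<le>
    i + j + (if v \<in> {vtx (Suc i) 0, vtx (m - Suc j) \<Delta>} then 1 else 0)"
proof -
  let ?\<beta> = "recolour_choice G \<alpha> (v, c)"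
  have weaker: "good_between \<alpha> (Suc i) j" "good_between \<alpha> i (Suc j)"
    using gap by (auto simp: good_between_def)
  consider "v = vtx (Suc i) 0" | "v = vtx (m - Suc j) \<Delta>" "m \<le> Suc j"
    | "v = vtx (m - Suc j) \<Delta>" "Suc j < m" | "v \<noteq> vtx (Suc i) 0" "v \<noteq> vtx (m - Suc j) \<Delta>"
    by linarith
  then show ?thesis
  proof cases
    case 1
    have "good_between ?\<beta> (Suc i) j"
      using 1 \<Delta> by (intro good_between_step[OF \<alpha> weaker(1) c]) auto
    then show ?thesis
      using 1 damage_le by fastforce
  next
    case 2
    \<comment> \<open>The run is empty here. Shortening would not help, as \<open>m - Suc j\<close>
      and \<open>m - Suc (Suc j)\<close> are both 0.\<close>
    have "good_between ?\<beta> i j"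
      using 2 by (auto simp: good_between_def)
    then show ?thesis
      using damage_le by fastforce
  next
    case 3
    have "good_between ?\<beta> i (Suc j)"
      using 3 \<Delta> by (intro good_between_step[OF \<alpha> weaker(2) c]) auto
    then show ?thesis
      using 3 damage_le by fastforce
  next
    case 4
    then have "good_between ?\<beta> i j"
      by (intro good_between_step[OF \<alpha> gap c])
    then show ?thesis
      using damage_le by fastforce
  qed
qed

section \<open>Expected damage and its tail\<close>

text \<open>Damage grows only if one of the two outer ends of an optimal run is drawn, and then by
  at most one; the vertex is uniform among \<open>m * Suc \<Delta>\<close>.\<close>

lemma expected_damage_glauber:
  assumes \<alpha>: "\<alpha> \<in> Col"
  shows "(\<integral>\<^sup>+\<beta>. ennreal (damage \<beta>) \<partial>measure_pmf (glauber G (Suc \<Delta>) \<alpha>))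
    \<le> ennreal (damage \<alpha>) + ennreal (2 / real (m * Suc \<Delta>))"
proof -
  obtain i j where ij: "damage \<alpha> = i + j" "good_between \<alpha> i j"
    by (rule damage_witness)
  \<comment> \<open>For an empty run, \<open>W\<close> may leave the vertex set; only an upper bound
    on the number of harmful draws is used.\<close>
  define W where "W = {vtx (Suc i) 0, vtx (m - Suc j) \<Delta>}"
  let ?C = "pverts G \<times> {1..Suc \<Delta>}"
  let ?B = "W \<times> {1..Suc \<Delta>}"
  have C: "finite ?C" "?C \<noteq> {}"
    using finite_verts verts_nonempty by auto
  have "(\<integral>\<^sup>+\<beta>. ennreal (damage \<beta>) \<partial>measure_pmf (glauber G (Suc \<Delta>) \<alpha>))
      = (\<integral>\<^sup>+p. ennreal (damage (recolour_choice G \<alpha> p)) \<partial>measure_pmf (pmf_of_set ?C))"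
    by (simp add: glauber_eq)
  also have "\<dots> \<le> (\<integral>\<^sup>+p. ennreal (damage \<alpha>) + indicator ?B p \<partial>measure_pmf (pmf_of_set ?C))"
  proof (rule nn_integral_mono_AE, unfold AE_measure_pmf_iff set_pmf_of_set[OF C(2,1)], rule ballI)
    fix p assume "p \<in> ?C"
    then obtain v c where p: "p = (v, c)" "c \<in> {1..Suc \<Delta>}"
      by auto
    have "damage (recolour_choice G \<alpha> p) \<le> damage \<alpha> + (if p \<in> ?B then 1 else 0)"
      using good_between_grow[OF \<alpha> ij(2) p(2), of v, folded W_def] p
      by (cases "v \<in> W") (simp_all add: ij(1))
    then have "ennreal (damage (recolour_choice G \<alpha> p)) \<le> ennreal (damage \<alpha> + (if p \<in> ?B then 1 else 0))"
      by (intro ennreal_leI) (simp split: if_splits)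
    also have "\<dots> = ennreal (damage \<alpha>) + indicator ?B p"
      by (cases "p \<in> ?B") simp_all
    finally show "ennreal (damage (recolour_choice G \<alpha> p)) \<le> ennreal (damage \<alpha>) + indicator ?B p" .
  qed
  also have "\<dots> = ennreal (damage \<alpha>) + emeasure (measure_pmf (pmf_of_set ?C)) ?B"
    by (simp add: nn_integral_add)
  also have "emeasure (measure_pmf (pmf_of_set ?C)) ?B = ennreal (real (card (?C \<inter> ?B)) / real (card ?C))"
    using C by (simp add: emeasure_pmf_of_set)
  also have "\<dots> \<le> ennreal (2 / real (m * Suc \<Delta>))"
  proof (rule ennreal_leI)
    have "card (?C \<inter> ?B) \<le> card ?B"
      by (intro card_mono) (auto simp: W_def)
    also have "\<dots> = card W * Suc \<Delta>"
      by (simp add: card_cartesian_product)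
    also have "\<dots> \<le> 2 * Suc \<Delta>"
      by (intro mult_right_mono) (auto simp: W_def card_insert_if)
    finally have "real (card (?C \<inter> ?B)) \<le> 2 * real (Suc \<Delta>)"
      by (metis of_nat_le_iff of_nat_mult of_nat_numeral)
    then have "real (card (?C \<inter> ?B)) / real (card ?C) \<le> 2 * real (Suc \<Delta>) / real (card ?C)"
      by (rule divide_right_mono) simp
    also have "\<dots> = 2 / real (m * Suc \<Delta>)"
    proof -
      have "card ?C = m * Suc \<Delta> * Suc \<Delta>"
        by (simp only: card_cartesian_product card_verts card_atLeastAtMost) simp
      then show ?thesis
        by (simp only: of_nat_mult[of _ "Suc \<Delta>"]) (simp del: of_nat_mult of_nat_Suc mult_Suc_right)
    qed
    finally show "real (card (?C \<inter> ?B)) / real (card ?C) \<le> 2 / real (m * Suc \<Delta>)" .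
  qed
  finally show ?thesis
    by simp
qed

lemma steps_Col: "\<alpha> \<in> Col \<Longrightarrow> set_pmf (steps (glauber G (Suc \<Delta>)) t \<alpha>) \<subseteq> Col"
  by (induction t) (use recolours_colouring in \<open>auto simp: set_pmf_glauber subset_iff\<close>)

lemma expected_damage:
  assumes \<alpha>: "\<alpha> \<in> Col"
  shows "(\<integral>\<^sup>+\<beta>. ennreal (damage \<beta>) \<partial>measure_pmf (steps (glauber G (Suc \<Delta>)) t \<alpha>))
    \<le> ennreal (damage \<alpha> + t * (2 / real (m * Suc \<Delta>)))"
proof (induction t)
  case (Suc t)
  let ?\<mu> = "steps (glauber G (Suc \<Delta>)) t \<alpha>"
  let ?e = "2 / real (m * Suc \<Delta>)"
  have "(\<integral>\<^sup>+\<beta>. ennreal (damage \<beta>) \<partial>measure_pmf (steps (glauber G (Suc \<Delta>)) (Suc t) \<alpha>))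
      = (\<integral>\<^sup>+\<gamma>. \<integral>\<^sup>+\<beta>. ennreal (damage \<beta>) \<partial>measure_pmf (glauber G (Suc \<Delta>) \<gamma>) \<partial>measure_pmf ?\<mu>)"
    by simp
  also have "\<dots> \<le> (\<integral>\<^sup>+\<gamma>. ennreal (damage \<gamma>) + ennreal ?e \<partial>measure_pmf ?\<mu>)"
    using steps_Col[OF \<alpha>, of t] expected_damage_glauber
    by (intro nn_integral_mono_AE) (auto simp only: AE_measure_pmf_iff)
  also have "\<dots> = (\<integral>\<^sup>+\<gamma>. ennreal (damage \<gamma>) \<partial>measure_pmf ?\<mu>) + ennreal ?e"
    by (simp add: nn_integral_add)
  also have "\<dots> \<le> ennreal (damage \<alpha> + t * ?e) + ennreal ?e"
    by (intro add_right_mono Suc.IH)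
  also have "\<dots> = ennreal (damage \<alpha> + t * ?e + ?e)"
    by (intro ennreal_plus[symmetric]) auto
  also have "damage \<alpha> + t * ?e + ?e = damage \<alpha> + Suc t * ?e"
    by (simp add: algebra_simps add_divide_distrib)
  finally show ?case .
qed simp

text \<open>Markov's inequality for the damage, multiplied by \<open>k\<close>.\<close>

lemma damage_tail:
  assumes \<alpha>: "\<alpha> \<in> Col"
  shows "k * measure_pmf.prob (steps (glauber G (Suc \<Delta>)) t \<alpha>) {\<beta>. k \<le> damage \<beta>}
    \<le> damage \<alpha> + t * (2 / real (m * Suc \<Delta>))"
proof -
  let ?\<mu> = "steps (glauber G (Suc \<Delta>)) t \<alpha>"
  let ?D = "{\<beta>. k \<le> damage \<beta>}"
  have "ennreal (k * measure_pmf.prob ?\<mu> ?D) = ennreal k * emeasure (measure_pmf ?\<mu>) ?D"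
    by (simp add: ennreal_mult measure_pmf.emeasure_eq_measure)
  also have "\<dots> = (\<integral>\<^sup>+\<beta>. ennreal k * indicator ?D \<beta> \<partial>measure_pmf ?\<mu>)"
    by (rule nn_integral_cmult_indicator[symmetric]) simp
  also have "\<dots> \<le> (\<integral>\<^sup>+\<beta>. ennreal (damage \<beta>) \<partial>measure_pmf ?\<mu>)"
    by (intro nn_integral_mono) (auto simp: indicator_def intro!: ennreal_leI)
  also have "\<dots> \<le> ennreal (damage \<alpha> + t * (2 / real (m * Suc \<Delta>)))"
    by (rule expected_damage[OF \<alpha>])
  finally show ?thesis
    by (subst (asm) ennreal_le_iff) (auto intro!: add_nonneg_nonneg)
qed

section \<open>The starting colouring and the lower bound\<close>

definition start_colour :: "nat \<Rightarrow> nat \<Rightarrow> nat" where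
  "start_colour i j =
    (if i = 0 then if j = 0 \<or> j = \<Delta> then 3 else if j = 1 then 1 else j + 2
     else if j = 0 then 1 else if j = \<Delta> then 2 else j + 2)"

definition start :: "nat \<Rightarrow> nat" where
  "start = (\<lambda>x\<in>pverts G. start_colour ((x - 1) div Suc \<Delta>) ((x - 1) mod Suc \<Delta>))"

lemma start_vtx: "i < m \<Longrightarrow> j \<le> \<Delta> \<Longrightarrow> start (vtx i j) = start_colour i j"
proof -
  assume *: "i < m" "j \<le> \<Delta>"
  have "(i * Suc \<Delta> + j) div Suc \<Delta> = i" "(i * Suc \<Delta> + j) mod Suc \<Delta> = j"
    using * by (simp_all del: mult_Suc_right)
  then show ?thesis
    using vtx_in_verts[OF *] unfolding start_def by (simp add: vtx_def del: mult_Suc_right)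
qed

lemma start_colour_adj:
  assumes "i < m" "j \<le> \<Delta>" "i' < m" "j' \<le> \<Delta>" "adj i j i' j'"
  shows "start_colour i j \<noteq> start_colour i' j'"
proof -
  consider "i = i'" "j \<noteq> j'" "(j, j') \<noteq> (0, \<Delta>)" "(j, j') \<noteq> (\<Delta>, 0)"
    | "j = \<Delta>" "j' = 0" "i \<noteq> i'" | "j = 0" "j' = \<Delta>" "i \<noteq> i'"
    using assms(5) nxt_neq unfolding adj_def by metis
  then show ?thesis
    using \<Delta> by cases (auto simp: start_colour_def)
qed

lemma start_Col: "start \<in> Col"
proof -
  have "start_colour i j \<in> {1..Suc \<Delta>}" if "j \<le> \<Delta>" for i j
    using that \<Delta> by (auto simp: start_colour_def)
  then have "start \<in> pverts G \<rightarrow>\<^sub>E {1..Suc \<Delta>}"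
    by (auto simp: start_def less_Suc_eq_le[symmetric])
  moreover have "start x \<noteq> start y" if "(x, y) \<in> parcs G" for x y
    using that start_colour_adj by (auto simp: arcs_eq start_vtx)
  ultimately show ?thesis
    by (simp add: colourings_def)
qed

lemma start_nonfrozen: "start \<in> nonfrozen G (Suc \<Delta>)"
  unfolding nonfrozen_iff
proof (intro conjI bexI)
  \<comment> \<open>Position 1 is a middle vertex, so its neighbours all lie in block 0, where 2 is
    missing.\<close>
  show "vtx 0 1 \<in> pverts G" "2 \<in> {1..Suc \<Delta>}"
    using k \<Delta> by auto
  show "2 \<noteq> start (vtx 0 1)"
    using k \<Delta> by (simp add: start_vtx start_colour_def)
  show "2 \<notin> start ` neighbourhood G (vtx 0 1)"
    using k \<Delta> by (auto simp: neighbourhood_middle start_vtx start_colour_def split: if_splits)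
qed (rule start_Col)

lemma damage_start: "damage start = 0"
proof -
  have "good_between start 0 0"
    using \<Delta> by (auto simp: good_between_def good_def start_vtx start_colour_def)
  then show ?thesis
    using damage_le by fastforce
qed

sublocale symmetric_chain "nonfrozen G (Suc \<Delta>)" "glauber G (Suc \<Delta>)"
  using start_nonfrozen nonfrozen_connected by (intro symmetric_chain_nonfrozen) auto

text \<open>The distinguishing event is that the first vertex of block \<open>k\<close> has colour
  1.\<close>

lemma mixing_time_lower_bound:
  "real (mixing_time (nonfrozen G (Suc \<Delta>)) (glauber G (Suc \<Delta>))) \<ge> k * real (m * Suc \<Delta>) / 4"
proof (rule ccontr)
  let ?S = "nonfrozen G (Suc \<Delta>)"
  define t where "t = mixing_time ?S (glauber G (Suc \<Delta>))"
  define n where "n = real (m * Suc \<Delta>)"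
  define \<mu> where "\<mu> = steps (glauber G (Suc \<Delta>)) t start"
  let ?A = "{\<beta> \<in> ?S. \<beta> (vtx k 0) = 1}"
  let ?D = "{\<beta>. k \<le> damage \<beta>}"
  assume "\<not> ?thesis"
  then have t: "t < k * n / 4"
    by (simp add: t_def n_def)
  have "n > 0"
    using k unfolding n_def of_nat_0_less_iff by simp
  have "k * measure_pmf.prob \<mu> ?D \<le> t * (2 / n)"
    using damage_tail[OF start_Col, of t] damage_start by (simp add: \<mu>_def n_def)
  \<comment> \<open>The constant in the bound is chosen here: \<open>t < k * n / 4\<close> keeps the
    expected damage \<open>2 * t / n\<close> below \<open>k / 2\<close>.\<close>
  also have "\<dots> < k * (1 / 2)"
    using t \<open>n > 0\<close> by (simp add: field_simps)
  finally have D: "measure_pmf.prob \<mu> ?D < 1 / 2"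
    using k by (subst (asm) mult_less_cancel_left_pos) auto
  have "set_pmf \<mu> \<subseteq> ?A \<union> ?D"
  proof
    fix \<beta> assume "\<beta> \<in> set_pmf \<mu>"
    then have "\<beta> \<in> ?S"
      using steps_closed[OF start_nonfrozen] unfolding \<mu>_def by blast
    then show "\<beta> \<in> ?A \<union> ?D"
      using small_damage_good[of \<beta>] by (auto simp: good_def not_le)
  qed
  then have "measure_pmf.prob \<mu> (?A \<union> ?D) = 1"
    by (subst measure_pmf.prob_eq_1) (auto simp: AE_measure_pmf_iff)
  then have A: "measure_pmf.prob \<mu> ?A > 1 / 2"
    using D measure_Un_le[of ?A \<mu> ?D] by simp
  have "vtx k 0 \<in> pverts G"
    using k by simp
  then have "Suc \<Delta> * card ?A \<le> card ?S"
    using colour_symmetry[of "vtx k 0" 1] by simp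
  \<comment> \<open>With at least four colours, the stationary probability of the event is at most 1
    / 4.\<close>
  moreover have "4 * card ?A \<le> Suc \<Delta> * card ?A"
    by (rule mult_right_mono) (use \<Delta> in simp_all)
  ultimately have "4 * card ?A \<le> card ?S"
    by (rule order_trans[rotated])
  then have "4 * real (card ?A) \<le> real (card ?S)"
    by linarith
  moreover have "card ?S > 0"
    using card_gt_0_iff[of ?S] finite_S S_nonempty by blast
  ultimately have "real (card ?A) / real (card ?S) \<le> 1 / 4"
    unfolding of_nat_0_less_iff[symmetric, where 'a = real] by (subst pos_divide_le_eq) linarith+
  moreover have "?S \<inter> ?A = ?A"
    by blast
  ultimately have \<pi>: "measure_pmf.prob (pmf_of_set ?S) ?A \<le> 1 / 4"
    by (simp only: measure_pmf_of_set[OF S_nonempty finite_S])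
  \<comment> \<open>Strictly more than 1 / 2 against at most 1 / 4 leaves a gap exceeding 1 / 4,
    impossible at the mixing time.\<close>
  have "\<bar>measure_pmf.prob \<mu> ?A - measure_pmf.prob (pmf_of_set ?S) ?A\<bar> \<le> 1 / 4"
    unfolding \<mu>_def t_def using start_nonfrozen Collect_restrict by (rule close_at_mixing_time)
  then show False
    using A \<pi> by linarith
qed

end

theorem proposition3:
  fixes \<Delta> k n :: nat
  assumes "\<Delta> \<ge> 3" and "k \<ge> 5" and "n = 2 * k * (\<Delta> + 1)"
  shows "\<exists>G :: nat pair_pre_digraph.
    pair_graph G \<and> pverts G = {1..n} \<and> regular_graph \<Delta> G \<and>
    (let \<H> = with_proj (recolouring_graph G (\<Delta> + 1))
               \<restriction> (colourings G (\<Delta> + 1) - frozen_colourings G (\<Delta> + 1));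
         K = glauber G (\<Delta> + 1)
     in markov_chain_on (verts \<H>) K \<and>
        ergodic_on (verts \<H>) K \<and>
        real (mixing_time (verts \<H>) K) \<ge> (real n)\<^sup>2 / (8 * (real \<Delta> + 1)))"
proof -
  interpret necklace \<Delta> k
    using assms by unfold_locales auto
  \<comment> \<open>Substituting \<open>n = 2 * k * (\<Delta> + 1)\<close> for one factor cancels
    \<open>\<Delta> + 1\<close> and leaves \<open>k * n / 4\<close>.\<close>
  have "(real n)\<^sup>2 / (8 * (real \<Delta> + 1)) = k * real (2 * k * Suc \<Delta>) / 4"
    by (simp add: assms(3) power2_eq_square field_simps)
  also have "\<dots> \<le> mixing_time (nonfrozen G (Suc \<Delta>)) (glauber G (Suc \<Delta>))"
    by (rule mixing_time_lower_bound)
  finally have "(real n)\<^sup>2 / (8 * (real \<Delta> + 1))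
      \<le> mixing_time (nonfrozen G (Suc \<Delta>)) (glauber G (Suc \<Delta>))" .
  moreover have "pverts G = {1..n}"
    by (simp add: G_def assms(3))
  ultimately show ?thesis
    unfolding Let_def induce_subgraph_verts
    using pair_graph_G regular_G chain ergodic
    by (intro exI[of _ G]) simp
qed

end
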